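(* Let $p\in(1,\infty)$, let $K$ be a non-empty set and let $(\mathcal{E}_p,\mathcal{F}_p)$ be a $p$-resistance form on $K$. Then the functional $\mathcal{E}_p:\mathcal{F}_p/\mathbb{R}\mathbf 1_K\to\mathbb{R}$ induced on the quotient is Fréchet differentiable on the normed space $(\mathcal{F}_p/\mathbb{R}\mathbf 1_K,\mathcal{E}_p^{1/p})$. In particular, for any $u,v\in\mathcal{F}_p$ the derivative $$\mathcal{E}_p(u;v):=\frac1p\frac{d}{dt}\mathcal{E}_p(u+tv)\Big|_{t=0}\in\mathbb{R}$$ exists, $\mathcal{E}_p(u;\cdot):\mathcal{F}_p\to\mathbb{R}$ is linear, $\mathcal{E}_p(u;u)=\mathcal{E}_p(u)$ and $\mathcal{E}_p(u;\mathbf 1_K)=0$. Moreover, for any $u,u_1,u_2,v\in\mathcal{F}_p$ and any $a\in\mathbb{R}$: (a) $\mathbb{R}\ni t\mapsto\mathcal{E}_p(u+tv;v)\in\mathbb{R}$ is strictly increasing if and only if $v\notin\mathbb{R}\mathbf 1_K$; (b) $\mathcal{E}_p(au;v)=\operatorname{sgn}(a)|a|^{p-1}\mathcal{E}_p(u;v)$ and $\mathcal{E}_p(u+a\mathbf 1_K;v)=\mathcal{E}_p(u;v)$; (c) $|\mathcal{E}_p(u;v)|\le\mathcal{E}_p(u)^{(p-1)/p}\mathcal{E}_p(v)^{1/p}$; (d) $|\mathcal{E}_p(u_1;v)-\mathcal{E}_p(u_2;v)|\le c_p\bigl(\mathcal{E}_p(u_1)\vee\mathcal{E}_p(u_2)\bigr)^{(p-1-\alpha_p)/p}\mathcal{E}_p(u_1-u_2)^{\alpha_p/p}\mathcal{E}_p(v)^{1/p}$,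 where $\alpha_p:=\frac1p\wedge\frac{p-1}{p}$ and $c_p\in(0,\infty)$ is some constant determined solely and explicitly by $p$.
   Context: $\|x\|_{\ell^s}=(\sum_k|x_k|^s)^{1/s}$ for $s\in(0,\infty)$, $\|x\|_{\ell^\infty}=\max_k|x_k|$; $\mathbf 1_K$ is the constant function $1$ on $K$; $\sup\emptyset:=0$; $\operatorname{sgn}(0)=0$; $a\wedge b$, $a\vee b$ are minimum and maximum. A $p$-resistance form on a non-empty set $K$ is a pair $(\mathcal{E}_p,\mathcal{F}_p)$ of a linear subspace $\mathcal{F}_p\subset\mathbb{R}^K$ and a functional $\mathcal{E}_p:\mathcal{F}_p\to[0,\infty)$ such that: (RF1) $\mathcal{E}_p^{1/p}$ is a seminorm on $\mathcal{F}_p$ and $\{u\in\mathcal{F}_p:\mathcal{E}_p(u)=0\}=\mathbb{R}\mathbf 1_K$; (RF2) $(\mathcal{F}_p/\mathbb{R}\mathbf 1_K,\mathcal{E}_p^{1/p})$ is a Banach space; (RF3) for any $x\ne y$ in $K$ there is $u\in\mathcal{F}_p$ with $u(x)\neq u(y)$; (RF4) $\sup\{|u(x)-u(y)|^p/\mathcal{E}_p(u)\mid u\in\mathcal{F}_p\setminus\mathbb{R}\mathbf 1_K\}<\infty$ for any $x,y\in K$; (RF5) (generalized contraction property) if $q\in(0,p]$, $r\in[p,\infty]$, $m,n\in\mathbb{N}$ and $T=(T_1,\dots,T_n):\mathbb{R}^m\to\mathbb{R}^n$ satisfies $T(0)=0$ and $\|T(x)-T(y)\|_{\ell^r}\le\|x-y\|_{\ell^q}$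 for all $x,y\in\mathbb{R}^m$, then for any $u=(u_1,\dots,u_m)\in\mathcal{F}_p^m$, $T(u)=(T_1(u),\dots,T_n(u))\in\mathcal{F}_p^n$ and $\|(\mathcal{E}_p(T_k(u))^{1/p})_{k=1}^n\|_{\ell^r}\le\|(\mathcal{E}_p(u_j)^{1/p})_{j=1}^m\|_{\ell^q}$. *)

theory Defs
  imports "HOL-Analysis.Analysis" "HOL-Library.Function_Algebras" "HOL-Library.Set_Algebras"
begin

text \<open>The non-empty set \<open>K\<close> is an arbitrary type \<open>'k\<close>, and a function on \<open>K\<close> is an element of
  \<open>'k \<Rightarrow> real\<close>, with pointwise addition from \<open>Function_Algebras\<close>.\<close>

definition fscale :: "real \<Rightarrow> ('k \<Rightarrow> real) \<Rightarrow> 'k \<Rightarrow> real" (infixr "*\<^sub>f" 75)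
  where "a *\<^sub>f u = (\<lambda>x. a * u x)"

lemma module_fscale: "module ((*\<^sub>f) :: real \<Rightarrow> ('k \<Rightarrow> real) \<Rightarrow> 'k \<Rightarrow> real)"
  by standard (auto simp: fscale_def fun_eq_iff algebra_simps)

definition const_funs :: "('k \<Rightarrow> real) set"
  where "const_funs = range (\<lambda>c. c *\<^sub>f 1)"


text \<open>The quotient of \<open>F\<close> by the constants. Its elements are the cosets \<open>u +o const_funs\<close>. The sum of
  two cosets is their elementwise sum \<open>X + Y\<close> from \<open>Set_Algebras\<close>. In \<open>quot_scale\<close> the summand
  \<open>const_funs\<close> only matters for \<open>a = 0\<close>, where the image alone would be \<open>{0}\<close>.\<close>

definition quot :: "('k \<Rightarrow> real) set \<Rightarrow> ('k \<Rightarrow> real) set set"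
  where "quot F = (\<lambda>u. u +o const_funs) ` F"

definition quot_scale :: "real \<Rightarrow> ('k \<Rightarrow> real) set \<Rightarrow> ('k \<Rightarrow> real) set"
  where "quot_scale a X = ((*\<^sub>f) a ` X) + const_funs"

text \<open>The functional induced by \<open>E\<close>: the common value of \<open>E\<close> on the coset.\<close>

definition quot_fun :: "(('k \<Rightarrow> real) \<Rightarrow> real) \<Rightarrow> ('k \<Rightarrow> real) set \<Rightarrow> real"
  where "quot_fun E X = the_elem (E ` X)"

definition quot_norm :: "real \<Rightarrow> (('k \<Rightarrow> real) \<Rightarrow> real) \<Rightarrow> ('k \<Rightarrow> real) set \<Rightarrow> real"
  where "quot_norm p E X = quot_fun E X powr (1 / p)"

definition quot_dist ::
  "real \<Rightarrow> (('k \<Rightarrow> real) \<Rightarrow> real) \<Rightarrow> ('k \<Rightarrow> real) set \<Rightarrow> ('k \<Rightarrow> real) set \<Rightarrow> real"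
  where "quot_dist p E X Y = quot_norm p E (X + quot_scale (-1) Y)"


text \<open>The norm of \<open>\<ell>\<^sup>s\<close> of the vector \<open>(x 0, \<dots>, x (n - 1))\<close>, for \<open>0 < s \<le> \<infinity>\<close> and \<open>n \<ge> 1\<close>.\<close>

definition ell_norm :: "ereal \<Rightarrow> nat \<Rightarrow> (nat \<Rightarrow> real) \<Rightarrow> real"
  where "ell_norm s n x =
    (if s = \<infinity> then Max ((\<lambda>k. \<bar>x k\<bar>) ` {..<n})
     else (\<Sum>k<n. \<bar>x k\<bar> powr real_of_ereal s) powr (1 / real_of_ereal s))"

text \<open>A map from \<open>\<real>\<^sup>m\<close> to \<open>\<real>\<^sup>n\<close> is represented by \<open>T :: (nat \<Rightarrow> real) \<Rightarrow> nat \<Rightarrow> real\<close>, where \<open>T x k\<close> with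
  \<open>k < n\<close> is the component of index \<open>k\<close>. The Lipschitz condition forces \<open>T x k\<close> to depend only on
  \<open>x 0, \<dots>, x (m - 1)\<close>.\<close>

definition generalized_contraction :: "real \<Rightarrow> ereal \<Rightarrow> nat \<Rightarrow> nat \<Rightarrow> ((nat \<Rightarrow> real) \<Rightarrow> nat \<Rightarrow> real) \<Rightarrow> bool"
  where "generalized_contraction q r m n T \<longleftrightarrow>
    (\<forall>k<n. T (\<lambda>_. 0) k = 0) \<and>
    (\<forall>x y. ell_norm r n (\<lambda>k. T x k - T y k) \<le> ell_norm (ereal q) m (\<lambda>j. x j - y j))"


text \<open>\<open>E\<close> is a total function, but only its values on \<open>F\<close> are constrained or used.\<close>

locale p_resistance_form =
  fixes p :: real and F :: "('k \<Rightarrow> real) set" and E :: "('k \<Rightarrow> real) \<Rightarrow> real"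
  assumes F_subspace: "module.subspace (*\<^sub>f) F"
    and E_nonneg: "\<And>u. u \<in> F \<Longrightarrow> 0 \<le> E u"
    and RF1_homogeneous: "\<And>a u. u \<in> F \<Longrightarrow> E (a *\<^sub>f u) powr (1 / p) = \<bar>a\<bar> * E u powr (1 / p)"
    and RF1_triangle:
      "\<And>u v. u \<in> F \<Longrightarrow> v \<in> F \<Longrightarrow> E (u + v) powr (1 / p) \<le> E u powr (1 / p) + E v powr (1 / p)"
    and RF1_kernel: "{u \<in> F. E u = 0} = const_funs"
    and RF2: "Metric_space.mcomplete (quot F) (quot_dist p E)"
    and RF3: "\<And>x y. x \<noteq> y \<Longrightarrow> \<exists>u\<in>F. u x \<noteq> u y"
    and RF4: "\<And>x y. bdd_above {\<bar>u x - u y\<bar> powr p / E u | u. u \<in> F - const_funs}"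
    and RF5: "\<And>q r m n T u. 0 < q \<Longrightarrow> q \<le> p \<Longrightarrow> ereal p \<le> r \<Longrightarrow> 1 \<le> m \<Longrightarrow> 1 \<le> n \<Longrightarrow>
      generalized_contraction q r m n T \<Longrightarrow> (\<forall>j<m. u j \<in> F) \<Longrightarrow>
      (\<forall>k<n. (\<lambda>x. T (\<lambda>j. u j x) k) \<in> F) \<and>
      ell_norm r n (\<lambda>k. E (\<lambda>x. T (\<lambda>j. u j x) k) powr (1 / p))
        \<le> ell_norm (ereal q) m (\<lambda>j. E (u j) powr (1 / p))"


definition linear_functional_on ::
  "'v set \<Rightarrow> ('v \<Rightarrow> 'v \<Rightarrow> 'v) \<Rightarrow> (real \<Rightarrow> 'v \<Rightarrow> 'v) \<Rightarrow> ('v \<Rightarrow> real) \<Rightarrow> bool"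
  where "linear_functional_on V add smul L \<longleftrightarrow>
    (\<forall>x\<in>V. \<forall>y\<in>V. L (add x y) = L x + L y) \<and> (\<forall>a. \<forall>x\<in>V. L (smul a x) = a * L x)"

text \<open>The quotient depends on \<open>F\<close> and is not a type, so Frechet differentiability of a real functional
  at \<open>x\<close> is defined for a normed space given by a carrier \<open>V\<close>, its operations and its norm.\<close>

definition frechet_differentiable_at ::
  "'v set \<Rightarrow> ('v \<Rightarrow> 'v \<Rightarrow> 'v) \<Rightarrow> (real \<Rightarrow> 'v \<Rightarrow> 'v) \<Rightarrow> ('v \<Rightarrow> real) \<Rightarrow> ('v \<Rightarrow> real) \<Rightarrow> 'v \<Rightarrow> bool"
  where "frechet_differentiable_at V add smul nrm f x \<longleftrightarrow>
    (\<exists>D. linear_functional_on V add smul D \<and>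
         (\<exists>C. \<forall>h\<in>V. \<bar>D h\<bar> \<le> C * nrm h) \<and>
         (\<forall>\<epsilon>>0. \<exists>\<delta>>0. \<forall>h\<in>V. nrm h < \<delta> \<longrightarrow> \<bar>f (add x h) - f x - D h\<bar> \<le> \<epsilon> * nrm h))"


text \<open>The derivative \<open>E(u; v)\<close>.\<close>

definition form_deriv ::
  "real \<Rightarrow> (('k \<Rightarrow> real) \<Rightarrow> real) \<Rightarrow> ('k \<Rightarrow> real) \<Rightarrow> ('k \<Rightarrow> real) \<Rightarrow> real"
  where "form_deriv p E u v = 1 / p * deriv (\<lambda>t. E (u + t *\<^sub>f v)) 0"

definition alpha_p :: "real \<Rightarrow> real"
  where "alpha_p p = min (1 / p) ((p - 1) / p)"

text \<open>An explicit admissible Hoelder constant depending only on \<open>p\<close>; it is not optimal. An existential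
  quantifier inside a theorem about \<open>'k\<close> would let the constant depend on the type \<open>'k\<close>. Apply RF5 to
  a multiple of \<open>(x, y) \<mapsto> (x + y, x - y)\<close>, with \<open>q = r = p\<close> if \<open>p \<le> 2\<close> and with \<open>q = p / (p - 1)\<close>,
  \<open>r = p\<close> if \<open>p \<ge> 2\<close>. This bounds the second differences of \<open>E\<close>, and convexity then gives the constants
  \<open>(4 / p) * 2 powr ((p - 1)\<^sup>2 / p)\<close> and \<open>(4 * (p - 1) / p) * 2 powr (2 * p - 3 - 1 / p)\<close> respectively,
  both at most \<open>2 powr (2 * p + 1)\<close>.\<close>

definition c_p :: "real \<Rightarrow> real"
  where "c_p p = 2 powr (2 * p + 1)"

end

theory Submission
  imports Defs
begin

text \<open>Write \<open>N = E\<^sup>1\<^sup>/\<^sup>p\<close> and apply RF5 to multiples of \<open>(x, y) \<mapsto> (x + y, x - y)\<close>. With \<open>q = min p 2\<close> and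
  \<open>r = p\<close> this gives \<open>E (u + v) + E (u - v) \<le> 2 (N(u)\<^sup>q + c N(v)\<^sup>q)\<^sup>p\<^sup>/\<^sup>q\<close>, so that second differences of
  the convex function \<open>E\<close> are \<open>o(N(v))\<close>: this is Frechet differentiability. The inverse map, with \<open>q = p\<close>
  and \<open>r = max p 2\<close>, gives strict convexity modulo constants. The Hoelder estimate compares the
  tangents at \<open>u\<^sub>1\<close> and \<open>u\<^sub>2\<close>: the difference of the derivatives in direction \<open>h\<close> is at most the second
  difference at \<open>u\<^sub>2\<close> with increment \<open>u\<^sub>1 - u\<^sub>2 + h\<close>, where \<open>h\<close> is scaled so that \<open>N(h) = N(u\<^sub>1 - u\<^sub>2)\<close>.\<close>

subsection \<open>Inequalities for real powers\<close>

text \<open>Split off one factor, \<open>x powr k = x * x powr (k - 1)\<close>, and enlarge the base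
  of the remaining power to a + b.\<close>

lemma powr_superadditive:
  fixes a b k :: real
  assumes "0 \<le> a" "0 \<le> b" "1 \<le> k"
  shows "a powr k + b powr k \<le> (a + b) powr k"
proof (cases "a + b = 0")
  case False
  have eq: "x powr k = x * x powr (k - 1)" if "0 \<le> x" for x :: real
    using that by (cases "x = 0") (simp_all add: powr_mult_base)
  have "a * a powr (k - 1) \<le> a * (a + b) powr (k - 1)" "b * b powr (k - 1) \<le> b * (a + b) powr (k - 1)"
    using assms by (auto intro!: mult_left_mono powr_mono2)
  then show ?thesis
    using assms eq[of a] eq[of b] eq[of "a + b"] by (simp add: algebra_simps)
next
  case True
  then have "a = 0" "b = 0" using assms by auto
  then show ?thesis by simp
qed

text \<open>On positive arguments this is \<open>powr_convex\<close>. If an endpoint is 0, the claim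
  reduces to \<open>s powr k \<le> s\<close> for 0 < s < 1.\<close>

lemma convex_on_powr_nonneg:
  fixes k :: real
  assumes "1 \<le> k"
  shows "convex_on {0..} (\<lambda>x. x powr k)"
proof (rule convex_onI)
  fix t x y :: real
  assume t: "0 < t" "t < 1" and xy: "x \<in> {0..}" "y \<in> {0..}"
  have scaled: "(s * z) powr k \<le> s * z powr k" if "0 < s" "s < 1" "0 \<le> z" for s z :: real
  proof -
    have "s powr k \<le> s powr 1" using that assms by (intro powr_mono') auto
    then show ?thesis using that by (simp add: powr_mult mult_right_mono)
  qed
  show "((1 - t) *\<^sub>R x + t *\<^sub>R y) powr k \<le> (1 - t) * x powr k + t * y powr k"
  proof (cases "x = 0 \<or> y = 0")
    case True
    then show ?thesis using scaled[of t y] scaled[of "1 - t" x] assms t xy by auto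
  next
    case False
    then show ?thesis using assms t xy by (intro convex_onD[OF powr_convex]) auto
  qed
qed auto

lemma powr_midpoint_le:
  fixes a b k :: real
  assumes "0 \<le> a" "0 \<le> b" "1 \<le> k"
  shows "((a + b) / 2) powr k \<le> (a powr k + b powr k) / 2"
  using convex_onD[OF convex_on_powr_nonneg[OF assms(3)], of "1 / 2" a b] assms
  by (simp add: add_divide_distrib)

text \<open>This is the tangent inequality of the convex power at y, valid for either order of x and
  y. It is Young's inequality for the product of x and \<open>y powr (k - 1)\<close> with exponents
  k and k / (k - 1).\<close>

lemma powr_diff_le:
  fixes x y k :: real
  assumes "0 \<le> x" "0 \<le> y" "1 \<le> k"
  shows "y powr k - x powr k \<le> k * y powr (k - 1) * (y - x)"
proof (cases "k = 1 \<or> y = 0")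
  case True
  then show ?thesis using assms by (cases "y = 0") auto
next
  case False
  have "x * y powr (k - 1) \<le> x powr k / k + (y powr (k - 1)) powr (k / (k - 1)) / (k / (k - 1))"
    using assms False by (intro Youngs_inequality) (auto simp: field_simps)
  also have "(y powr (k - 1)) powr (k / (k - 1)) = y powr k"
    using False by (simp add: powr_powr)
  finally have "k * (x * y powr (k - 1)) \<le> x powr k + (k - 1) * y powr k"
    using assms False by (simp add: field_simps)
  moreover have "y powr k = y * y powr (k - 1)"
    using assms False by (simp add: powr_mult_base)
  ultimately show ?thesis by (simp add: algebra_simps)
qed

text \<open>A supporting line at 0 leaves nonnegative gaps at t and at -t. Their sum is the second
  difference, so each gap alone is o(t) and the slope of the line is the derivative.\<close>

lemma convex_differentiable_at_0:
  fixes f :: "real \<Rightarrow> real"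
  assumes "convex_on UNIV f"
    and small: "\<And>\<epsilon>. 0 < \<epsilon> \<Longrightarrow> \<exists>\<delta>>0. \<forall>t. \<bar>t\<bar> < \<delta> \<longrightarrow> f t + f (- t) - 2 * f 0 \<le> \<epsilon> * \<bar>t\<bar>"
  obtains m where "(f has_real_derivative m) (at 0)" "\<And>t. f 0 + m * t \<le> f t"
proof -
  obtain m where m: "f 0 + m * t \<le> f t" for t
    using convex_le_Inf_differential[OF assms(1), of 0] by auto
  have "(\<lambda>h. (f (0 + h) - f 0) / h) \<midarrow>0\<rightarrow> m"
  proof (rule LIM_I)
    fix r :: real
    assume "0 < r"
    then obtain d where d: "0 < d" "\<And>t. \<bar>t\<bar> < d \<Longrightarrow> f t + f (- t) - 2 * f 0 \<le> r / 2 * \<bar>t\<bar>"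
      using small[of "r / 2"] by auto
    have "norm ((f (0 + h) - f 0) / h - m) < r" if h: "h \<noteq> 0" "\<bar>h\<bar> < d" for h
    proof -
      have "\<bar>f h - f 0 - m * h\<bar> \<le> r / 2 * \<bar>h\<bar>"
        using d(2)[of h] m[of h] m[of "- h"] h by simp
      also have "\<dots> < r * \<bar>h\<bar>" using h \<open>0 < r\<close> by simp
      finally have "\<bar>f h - f 0 - m * h\<bar> / \<bar>h\<bar> < r" using h by (simp add: divide_less_eq)
      moreover have "(f h - f 0) / h - m = (f h - f 0 - m * h) / h" using h by (simp add: field_simps)
      ultimately show ?thesis by (simp add: abs_divide)
    qed
    then show "\<exists>s>0. \<forall>x. x \<noteq> 0 \<and> norm (x - 0) < s \<longrightarrow> norm ((f (0 + x) - f 0) / x - m) < r"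
      using d(1) by auto
  qed
  then have "(f has_real_derivative m) (at 0)" by (simp add: DERIV_def)
  then show thesis using m by (rule that)
qed

section \<open>Two-point inequalities for real numbers\<close>

lemma cosh_le_exp_half_square: "cosh t \<le> exp (t\<^sup>2 / 2)" for t :: real
proof -
  \<comment> \<open>The two power series are compared term by term, and this is the bound on the
    coefficients.\<close>
  have fact_bound: "2 ^ n * fact n \<le> (fact (2 * n) :: real)" for n
  proof (induction n)
    case (Suc n)
    have "2 ^ Suc n * fact (Suc n) = (2 * real n + 2) * (2 ^ n * fact n)"
      by (simp add: algebra_simps)
    also have "\<dots> \<le> (2 * real n + 2) * ((2 * real n + 1) * fact (2 * n))"
      using Suc.IH by (intro mult_left_mono) (auto intro: order_trans[OF _ mult_right_mono[of 1]])
    also have "\<dots> = fact (2 * Suc n)" by (simp add: algebra_simps)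
    finally show ?case .
  qed simp
  have "(\<lambda>n. if even n then t ^ n /\<^sub>R fact n else 0) sums cosh t"
    by (rule cosh_converges)
  then have "(\<lambda>n. t ^ (2 * n) /\<^sub>R fact (2 * n)) sums cosh t"
    by (subst (asm) sums_mono_reindex[of "\<lambda>n. 2 * n", symmetric])
      (auto simp: strict_mono_def elim!: evenE)
  moreover have "(\<lambda>n. (t\<^sup>2 / 2) ^ n /\<^sub>R fact n) sums exp (t\<^sup>2 / 2)"
    by (rule exp_converges)
  moreover have "t ^ (2 * n) /\<^sub>R fact (2 * n) \<le> (t\<^sup>2 / 2) ^ n /\<^sub>R fact n" for n
  proof -
    have "t ^ (2 * n) / fact (2 * n) \<le> t ^ (2 * n) / (2 ^ n * fact n)"
      using fact_bound[of n] by (intro divide_left_mono) auto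
    then show ?thesis by (simp only: power_mult power_divide) (simp add: divide_inverse mult_ac)
  qed
  ultimately show ?thesis by (rule sums_le[rotated 1])
qed

lemma abs_powr_eq_square_powr: "\<bar>x\<bar> powr p = (x\<^sup>2) powr (p / 2)"
  for x p :: real
proof -
  have "(x\<^sup>2) powr (p / 2) = (\<bar>x\<bar> powr 2) powr (p / 2)" by simp
  also have "\<dots> = \<bar>x\<bar> powr p" by (simp only: powr_powr) simp
  finally show ?thesis by simp
qed

text \<open>The detour through squares: the power mean with exponent 2 / p leads to the
  parallelogram identity, and superadditivity with the same exponent leads back.\<close>

lemma two_point_smooth_le2:
  fixes x y p :: real
  assumes "1 < p" "p \<le> 2"
  shows "\<bar>x + y\<bar> powr p + \<bar>x - y\<bar> powr p \<le> 2 * (\<bar>x\<bar> powr p + \<bar>y\<bar> powr p)"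
proof -
  define a b where "a = \<bar>x + y\<bar> powr p" and "b = \<bar>x - y\<bar> powr p"
  have k: "1 \<le> 2 / p" using assms by simp
  have root_eq: "(\<bar>z\<bar> powr p) powr (2 / p) = z\<^sup>2" for z
    using assms by (cases "z = 0") (simp_all add: powr_powr)
  have "((a + b) / 2) powr (2 / p) \<le> ((x + y)\<^sup>2 + (x - y)\<^sup>2) / 2"
    using powr_midpoint_le[OF _ _ k, of a b] by (simp add: a_def b_def root_eq)
  also have "\<dots> = x\<^sup>2 + y\<^sup>2" by (simp add: power2_eq_square algebra_simps)
  also have "\<dots> \<le> (\<bar>x\<bar> powr p + \<bar>y\<bar> powr p) powr (2 / p)"
    using powr_superadditive[OF _ _ k, of "\<bar>x\<bar> powr p" "\<bar>y\<bar> powr p"] by (simp add: root_eq)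
  finally have "(a + b) / 2 \<le> \<bar>x\<bar> powr p + \<bar>y\<bar> powr p"
    using powr_less_mono2[of "2 / p" "\<bar>x\<bar> powr p + \<bar>y\<bar> powr p" "(a + b) / 2"] assms
    by (intro leI notI) simp
  then show ?thesis by (simp add: a_def b_def)
qed

text \<open>The mirror image of the previous argument, now with exponent p / 2: superadditivity
  first, the power mean last.\<close>

lemma two_point_convex_ge2:
  fixes x y p :: real
  assumes "2 \<le> p"
  shows "\<bar>x\<bar> powr p + \<bar>y\<bar> powr p \<le> (\<bar>x + y\<bar> powr p + \<bar>x - y\<bar> powr p) / 2"
proof -
  have k: "1 \<le> p / 2" using assms by simp
  have "\<bar>x\<bar> powr p + \<bar>y\<bar> powr p \<le> (x\<^sup>2 + y\<^sup>2) powr (p / 2)"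
    unfolding abs_powr_eq_square_powr by (intro powr_superadditive k) auto
  also have "x\<^sup>2 + y\<^sup>2 = ((x + y)\<^sup>2 + (x - y)\<^sup>2) / 2" by (simp add: power2_eq_square algebra_simps)
  also have "\<dots> powr (p / 2) \<le> (\<bar>x + y\<bar> powr p + \<bar>x - y\<bar> powr p) / 2"
    unfolding abs_powr_eq_square_powr by (intro powr_midpoint_le k) auto
  finally show ?thesis .
qed

text \<open>For small s, bounding 1 + t by exp t turns the left side into a hyperbolic cosine, whose
  linear terms cancel; the factor 2 in 2 * p pays for exp z \<le> 1 + z + z * z \<le> 1 + 2 * z on
  [0, 1]. For large s each summand on its own is small enough.\<close>

lemma two_point_smooth_ge2_unit:
  fixes s p :: real
  assumes "2 \<le> p"
  shows "\<bar>1 + s\<bar> powr p + \<bar>1 - s\<bar> powr p \<le> 2 * (1 + 2 * p * s\<^sup>2) powr (p / 2)"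
proof (cases "p * s\<^sup>2 \<le> 1")
  case True
  have "s\<^sup>2 \<le> p * s\<^sup>2" using assms by (simp add: mult_le_cancel_right1)
  then have "s\<^sup>2 \<le> 1" using True by simp
  then have s: "\<bar>s\<bar> \<le> 1" using abs_square_le_1 by blast
  have bd: "\<bar>1 + t\<bar> powr p \<le> exp (p * t)" if "\<bar>t\<bar> \<le> 1" for t
  proof -
    have "\<bar>1 + t\<bar> powr p \<le> exp t powr p"
      using assms that exp_ge_add_one_self[of t] by (intro powr_mono2) auto
    then show ?thesis by (simp add: exp_powr_real mult.commute)
  qed
  have "\<bar>1 + s\<bar> powr p + \<bar>1 - s\<bar> powr p \<le> exp (p * s) + exp (- (p * s))"
    using bd[of s] bd[of "-s"] s by simp
  also have "\<dots> = 2 * cosh (p * s)" by (simp add: cosh_def)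
  also have "\<dots> \<le> 2 * exp ((p * s)\<^sup>2 / 2)" using cosh_le_exp_half_square by simp
  also have "exp ((p * s)\<^sup>2 / 2) = exp (p * s\<^sup>2) powr (p / 2)"
    by (simp add: exp_powr_real power2_eq_square mult_ac)
  also have "\<dots> \<le> (1 + 2 * p * s\<^sup>2) powr (p / 2)"
  proof (intro powr_mono2)
    have "exp (p * s\<^sup>2) \<le> 1 + p * s\<^sup>2 + (p * s\<^sup>2)\<^sup>2"
      using True assms by (intro exp_bound) auto
    also have "(p * s\<^sup>2)\<^sup>2 \<le> p * s\<^sup>2"
      using True assms by (simp add: power2_eq_square mult_left_le_one_le)
    finally show "exp (p * s\<^sup>2) \<le> 1 + 2 * p * s\<^sup>2" by simp
  qed (use assms in auto)
  finally show ?thesis by simp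
next
  case False
  \<comment> \<open>The linear term of the square of 1 + |s| is absorbed by the quadratic one; the
    leftover 1 / 2 is covered because \<open>p * s\<^sup>2\<close> exceeds 1.\<close>
  have "0 \<le> (2 * \<bar>s\<bar> - 1)\<^sup>2" by simp
  then have "2 * \<bar>s\<bar> \<le> 2 * s\<^sup>2 + 1 / 2" by (simp add: power2_eq_square algebra_simps)
  moreover have "2 * s\<^sup>2 \<le> p * s\<^sup>2" using assms by (intro mult_right_mono) auto
  ultimately have sq: "(1 + \<bar>s\<bar>)\<^sup>2 \<le> 1 + 2 * p * s\<^sup>2"
    using False by (simp add: power2_eq_square algebra_simps)
  have "\<bar>1 + t\<bar> powr p \<le> (1 + 2 * p * s\<^sup>2) powr (p / 2)" if "\<bar>t\<bar> = \<bar>s\<bar>" for t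
  proof -
    have "\<bar>1 + t\<bar>\<^sup>2 \<le> (1 + \<bar>s\<bar>)\<^sup>2" using that by (intro power_mono) auto
    with sq have "(1 + t)\<^sup>2 \<le> 1 + 2 * p * s\<^sup>2" by simp
    then show ?thesis
      unfolding abs_powr_eq_square_powr using assms by (intro powr_mono2) auto
  qed
  from this[of s] this[of "-s"] show ?thesis by simp
qed

text \<open>Both sides are homogeneous of degree p, so for nonzero x one may divide by x.\<close>

lemma two_point_smooth_ge2:
  fixes x y p :: real
  assumes "2 \<le> p"
  shows "\<bar>x + y\<bar> powr p + \<bar>x - y\<bar> powr p \<le> 2 * (\<bar>x\<bar> powr 2 + 2 * p * \<bar>y\<bar> powr 2) powr (p / 2)"
proof (cases "x = 0")
  case True
  have "\<bar>y\<bar> powr p \<le> (2 * p * y\<^sup>2) powr (p / 2)"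
    unfolding abs_powr_eq_square_powr using assms
    by (intro powr_mono2) (auto simp: mult_le_cancel_right1)
  then show ?thesis using True by simp
next
  case False
  define s where "s = y / x"
  have y: "y = x * s" using False by (simp add: s_def)
  have "\<bar>x + y\<bar> powr p + \<bar>x - y\<bar> powr p = \<bar>x\<bar> powr p * (\<bar>1 + s\<bar> powr p + \<bar>1 - s\<bar> powr p)"
  proof -
    have xy: "x + y = x * (1 + s)" "x - y = x * (1 - s)" by (simp_all add: y algebra_simps)
    show ?thesis unfolding xy by (simp add: abs_mult powr_mult distrib_left[of "\<bar>x\<bar> powr p"])
  qed
  also have "\<dots> \<le> \<bar>x\<bar> powr p * (2 * (1 + 2 * p * s\<^sup>2) powr (p / 2))"
    by (intro mult_left_mono two_point_smooth_ge2_unit assms) auto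
  also have "\<dots> = 2 * (x\<^sup>2 * (1 + 2 * p * s\<^sup>2)) powr (p / 2)"
    using assms by (subst powr_mult) (auto simp: abs_powr_eq_square_powr)
  also have "x\<^sup>2 * (1 + 2 * p * s\<^sup>2) = \<bar>x\<bar> powr 2 + 2 * p * \<bar>y\<bar> powr 2"
    by (simp add: y power2_eq_square algebra_simps)
  finally show ?thesis .
qed

text \<open>After both vectors are normalised, Young's inequality in each coordinate adds up to 1 /
  p + 1 / q = 1.\<close>

lemma Holder_two:
  fixes a b c d p q :: real
  assumes "1 < p" "1 / p + 1 / q = 1"
  shows "\<bar>a * c + b * d\<bar> \<le> (\<bar>a\<bar> powr p + \<bar>b\<bar> powr p) powr (1 / p) * (\<bar>c\<bar> powr q + \<bar>d\<bar> powr q) powr (1 / q)"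
proof -
  have q: "1 < q"
  proof -
    have "1 / q = 1 - 1 / p" "0 < 1 / p" "1 / p < 1" using assms by auto
    then have "0 < 1 / q" "1 / q < 1" by auto
    then show ?thesis by (metis divide_less_eq_1_pos zero_less_divide_1_iff)
  qed
  define A B where "A = (\<bar>a\<bar> powr p + \<bar>b\<bar> powr p) powr (1 / p)" 
    and "B = (\<bar>c\<bar> powr q + \<bar>d\<bar> powr q) powr (1 / q)"
  have Ap: "A powr p = \<bar>a\<bar> powr p + \<bar>b\<bar> powr p" and Bq: "B powr q = \<bar>c\<bar> powr q + \<bar>d\<bar> powr q"
    using assms q by (auto simp: A_def B_def powr_powr)
  show ?thesis
  proof (cases "A = 0 \<or> B = 0")
    case True
    then have "(a = 0 \<and> b = 0) \<or> (c = 0 \<and> d = 0)"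
      by (auto simp: A_def B_def add_nonneg_eq_0_iff)
    then show ?thesis by auto
  next
    case False
    then have pos: "0 < A" "0 < B" by (auto simp: A_def B_def)
    have young: "\<bar>x\<bar> / A * (\<bar>z\<bar> / B) \<le> \<bar>x\<bar> powr p / A powr p / p + \<bar>z\<bar> powr q / B powr q / q" for x z
    proof -
      have "\<bar>x\<bar> / A * (\<bar>z\<bar> / B) \<le> (\<bar>x\<bar> / A) powr p / p + (\<bar>z\<bar> / B) powr q / q"
        using assms q pos by (intro Youngs_inequality) auto
      then show ?thesis using pos by (simp add: powr_divide)
    qed
    have "(\<bar>a\<bar> * \<bar>c\<bar> + \<bar>b\<bar> * \<bar>d\<bar>) / (A * B) = \<bar>a\<bar> / A * (\<bar>c\<bar> / B) + \<bar>b\<bar> / A * (\<bar>d\<bar> / B)"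
      by (simp add: add_divide_distrib)
    also have "\<dots> \<le> (\<bar>a\<bar> powr p + \<bar>b\<bar> powr p) / A powr p / p + (\<bar>c\<bar> powr q + \<bar>d\<bar> powr q) / B powr q / q"
      using young[of a c] young[of b d] by (simp add: add_divide_distrib)
    also have "\<dots> = 1"
      using pos assms by (simp flip: Ap Bq)
    finally have "\<bar>a\<bar> * \<bar>c\<bar> + \<bar>b\<bar> * \<bar>d\<bar> \<le> A * B"
      using pos by simp
    moreover have "\<bar>a * c + b * d\<bar> \<le> \<bar>a\<bar> * \<bar>c\<bar> + \<bar>b\<bar> * \<bar>d\<bar>"
      by (metis abs_mult abs_triangle_ineq)
    ultimately show ?thesis by (simp add: A_def B_def)
  qed
qed

text \<open>Dual to \<open>two_point_smooth_ge2\<close> at the conjugate exponent \<open>s\<close>: pair the vector \<open>(x + y, x - y)\<close>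
  with \<open>(x + c * y, x - c * y)\<close>, where \<open>c = 1 / (2 * s)\<close>.\<close>

lemma two_point_convex_le2:
  fixes x y p :: real
  assumes "1 < p" "p \<le> 2"
  shows "(\<bar>x\<bar> powr 2 + (p - 1) / (2 * p) * \<bar>y\<bar> powr 2) powr (p / 2)
    \<le> (\<bar>x + y\<bar> powr p + \<bar>x - y\<bar> powr p) / 2"
proof -
  define s where "s = p / (p - 1)"
  have s: "2 \<le> s" "1 / p + 1 / s = 1" using assms by (auto simp: s_def field_simps)
  define c where "c = (p - 1) / (2 * p)"
  have c: "0 < c" "2 * s * c = 1" using assms by (auto simp: c_def s_def)
  define Q where "Q = x\<^sup>2 + c * y\<^sup>2"
  define M where "M = \<bar>x + y\<bar> powr p + \<bar>x - y\<bar> powr p"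
  have Q0: "0 \<le> Q" using c by (simp add: Q_def)
  have "2 * Q = (x + y) * (x + c * y) + (x - y) * (x - c * y)"
    by (simp add: Q_def power2_eq_square algebra_simps)
  also have "\<dots> \<le> M powr (1 / p) * (\<bar>x + c * y\<bar> powr s + \<bar>x - c * y\<bar> powr s) powr (1 / s)"
    unfolding M_def using Holder_two[OF assms(1) s(2), of "x + y" "x + c * y" "x - y" "x - c * y"]
    by linarith
  also have "\<dots> \<le> M powr (1 / p) * (2 * Q powr (s / 2)) powr (1 / s)"
  proof (intro mult_left_mono powr_mono2)
    \<comment> \<open>The choice of c is made here: with 2 * s * c = 1 the smoothness bound at
      exponent s for x and c * y involves the same \<open>Q\<close> as the pairing.\<close>
    have "\<bar>x\<bar> powr 2 + 2 * s * \<bar>c * y\<bar> powr 2 = x\<^sup>2 + (2 * s * c) * c * y\<^sup>2"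
      by (simp add: power2_eq_square algebra_simps)
    also have "\<dots> = Q" by (simp add: c Q_def)
    finally show "\<bar>x + c * y\<bar> powr s + \<bar>x - c * y\<bar> powr s \<le> 2 * Q powr (s / 2)"
      using two_point_smooth_ge2[OF s(1), of x "c * y"] by simp
  qed (use s in auto)
  also have "(2 * Q powr (s / 2)) powr (1 / s) = 2 powr (1 / s) * Q powr (1 / 2)"
    using s Q0 by (simp add: powr_mult powr_powr)
  finally have *: "2 * Q \<le> M powr (1 / p) * (2 powr (1 / s) * Q powr (1 / 2))" .
  show ?thesis
  proof (cases "Q = 0")
    case True
    then show ?thesis by (simp add: Q_def c_def)
  next
    case False
    then have Qpos: "0 < Q" using Q0 by simp
    have "Q = Q powr (1 / 2) * Q powr (1 / 2)" using Qpos by (simp flip: powr_add)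
    then have "2 * Q powr (1 / 2) * Q powr (1 / 2) \<le> M powr (1 / p) * 2 powr (1 / s) * Q powr (1 / 2)"
      using * by (simp add: mult_ac)
    then have "2 * Q powr (1 / 2) \<le> M powr (1 / p) * 2 powr (1 / s)"
      using Qpos by simp
    \<comment> \<open>The 2 on the left is split by conjugacy so that \<open>2 powr (1 / s)\<close>
      cancels and the factor left over becomes 2 after taking the power p.\<close>
    moreover have "2 = 2 powr (1 / p) * 2 powr (1 / s)" using s(2) by (simp flip: powr_add)
    ultimately have "2 powr (1 / p) * Q powr (1 / 2) * 2 powr (1 / s) \<le> M powr (1 / p) * 2 powr (1 / s)"
      by (simp add: mult_ac)
    then have "2 powr (1 / p) * Q powr (1 / 2) \<le> M powr (1 / p)" by simp
    then have "(2 powr (1 / p) * Q powr (1 / 2)) powr p \<le> (M powr (1 / p)) powr p"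
      using assms by (intro powr_mono2) auto
    then have "2 * Q powr (p / 2) \<le> M"
      using assms by (simp add: powr_mult powr_powr M_def)
    then show ?thesis by (simp add: M_def Q_def c_def)
  qed
qed

text \<open>For such b the logarithm is at least 1, so \<open>b powr (x - 1)\<close> dominates 1 +
  (x - 1). With b = 4 this settles the numerical constants of the Hoelder estimate for p >
  2.\<close>

lemma linear_le_powr:
  fixes b x :: real
  assumes "exp 1 \<le> b" "1 \<le> x"
  shows "b * x \<le> b powr x"
proof -
  have b: "0 < b" using assms(1) less_le_trans[OF exp_gt_zero] by blast
  have "1 \<le> ln b" using assms(1) b by (simp add: ln_ge_iff)
  then have "x \<le> 1 + (x - 1) * ln b" using assms(2) mult_left_mono[of 1 "ln b" "x - 1"] by simp
  also have "\<dots> \<le> exp ((x - 1) * ln b)" by (rule exp_ge_add_one_self)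
  finally have "b * x \<le> b * b powr (x - 1)" using b by (simp add: powr_def)
  then show ?thesis using b by (simp add: powr_mult_base)
qed

subsection \<open>Cosets of the constants\<close>

lemma fscale_minus_left [simp]: "(- c) *\<^sub>f u = - (c *\<^sub>f u)"
  and fscale_one [simp]: "1 *\<^sub>f u = u"
  and fscale_zero [simp]: "0 *\<^sub>f u = 0"
  and fscale_fscale [simp]: "a *\<^sub>f (b *\<^sub>f u) = (a * b) *\<^sub>f u"
  by (simp_all add: fscale_def fun_eq_iff)

lemma fscale_add_right: "a *\<^sub>f (u + v) = a *\<^sub>f u + a *\<^sub>f v"
  and fscale_add_left: "(a + b) *\<^sub>f u = a *\<^sub>f u + b *\<^sub>f u"
  by (simp_all add: fscale_def fun_eq_iff algebra_simps)

lemma scale_const: "v \<in> const_funs \<Longrightarrow> a *\<^sub>f v \<in> const_funs"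
  and add_const: "v \<in> const_funs \<Longrightarrow> w \<in> const_funs \<Longrightarrow> v + w \<in> const_funs"
  and const_const: "c *\<^sub>f 1 \<in> const_funs"
  by (auto simp: const_funs_def simp flip: fscale_add_left)

lemma zero_const: "0 \<in> const_funs"
  using const_const[of 0] by simp

lemma coset_add:
  fixes u v :: "'k \<Rightarrow> real"
  shows "(u +o const_funs) + (v +o const_funs) = (u + v) +o const_funs"
proof -
  have "const_funs + const_funs = (const_funs :: ('k \<Rightarrow> real) set)"
  proof
    show "const_funs + const_funs \<subseteq> (const_funs :: ('k \<Rightarrow> real) set)"
      by (auto simp: set_plus_def add_const)
    show "(const_funs :: ('k \<Rightarrow> real) set) \<subseteq> const_funs + const_funs"
      by (rule set_zero_plus2[OF zero_const])
  qed
  then show ?thesis using set_plus_rearrange[of u const_funs v const_funs] by simp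
qed

lemma quot_scale_coset: "quot_scale a (u +o const_funs) = (a *\<^sub>f u) +o const_funs"
proof -
  have "(*\<^sub>f) a ` (u +o const_funs) + const_funs = (a *\<^sub>f u) +o const_funs"
  proof (intro equalityI subsetI)
    fix x assume "x \<in> (*\<^sub>f) a ` (u +o const_funs) + const_funs"
    then obtain w w' where w: "w \<in> const_funs" "w' \<in> const_funs" "x = a *\<^sub>f (u + w) + w'"
      by (auto simp: elt_set_plus_def set_plus_def)
    then have "x = a *\<^sub>f u + (a *\<^sub>f w + w')" by (simp add: fscale_add_right add_ac)
    moreover have "a *\<^sub>f w + w' \<in> const_funs" using w by (intro add_const scale_const)
    ultimately show "x \<in> (a *\<^sub>f u) +o const_funs" by (simp only: set_plus_intro2)
  next
    fix x assume "x \<in> (a *\<^sub>f u) +o const_funs"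
    then obtain w where w: "w \<in> const_funs" "x = a *\<^sub>f u + w" by (auto simp: elt_set_plus_def)
    moreover have "u \<in> u +o const_funs" using set_plus_intro2[OF zero_const, of u] by simp
    ultimately show "x \<in> (*\<^sub>f) a ` (u +o const_funs) + const_funs" by (blast)
  qed
  then show ?thesis by (simp add: quot_scale_def)
qed

text \<open>Evaluates a functional invariant under constants on a coset. It serves both the induced
  form and its derivative on the quotient.\<close>

lemma the_elem_coset:
  assumes "\<And>w. w \<in> const_funs \<Longrightarrow> g (u + w) = g u"
  shows "the_elem (g ` (u +o const_funs)) = g u"
proof -
  have "g ` (u +o const_funs) = {g u}"
    using assms zero_const by (auto simp: elt_set_plus_def image_iff intro!: bexI[of _ 0])
  then show ?thesis by simp
qed

subsection \<open>Convexity and smoothness of the form\<close>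

locale p_resistance = p_resistance_form +
  assumes p_gt_1: "1 < p"
begin

definition N :: "('a \<Rightarrow> real) \<Rightarrow> real"
  where "N u = E u powr (1 / p)"

lemma F_add: "u \<in> F \<Longrightarrow> v \<in> F \<Longrightarrow> u + v \<in> F"
  and F_scale: "u \<in> F \<Longrightarrow> a *\<^sub>f u \<in> F"
  and F_diff: "u \<in> F \<Longrightarrow> v \<in> F \<Longrightarrow> u - v \<in> F"
  using module.subspace_add[OF module_fscale F_subspace] module.subspace_scale[OF module_fscale F_subspace]
    module.subspace_diff[OF module_fscale F_subspace] by auto

lemma F_minus: "u \<in> F \<Longrightarrow> - u \<in> F"
  using F_scale[of u "-1"] by simp

lemmas F_closed = F_add F_scale F_diff F_minus

lemma N_nonneg: "0 \<le> N u"
  by (simp add: N_def)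

lemma E_eq_N_powr: "u \<in> F \<Longrightarrow> E u = N u powr p"
  using p_gt_1 E_nonneg[of u] by (simp add: N_def powr_powr)

lemma N_scale: "u \<in> F \<Longrightarrow> N (a *\<^sub>f u) = \<bar>a\<bar> * N u"
  unfolding N_def by (rule RF1_homogeneous)

lemma N_minus: "u \<in> F \<Longrightarrow> N (- u) = N u"
  using N_scale[of u "-1"] by simp

lemma N_triangle: "u \<in> F \<Longrightarrow> v \<in> F \<Longrightarrow> N (u + v) \<le> N u + N v"
  unfolding N_def by (rule RF1_triangle)

lemma E_scale: "u \<in> F \<Longrightarrow> E (a *\<^sub>f u) = \<bar>a\<bar> powr p * E u"
  by (simp add: E_eq_N_powr F_scale N_scale powr_mult N_nonneg)

lemma const_funs_subset: "const_funs \<subseteq> F"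
  and E_const: "v \<in> const_funs \<Longrightarrow> E v = 0"
  and N_pos_iff: "v \<in> F \<Longrightarrow> 0 < N v \<longleftrightarrow> v \<notin> const_funs"
  using RF1_kernel by (auto simp: N_def)

lemma E_add_const:
  assumes "u \<in> F" "w \<in> const_funs"
  shows "E (u + w) = E u"
proof -
  have w: "w \<in> F" "N w = 0" using assms const_funs_subset by (auto simp: N_def E_const)
  have "N (u + w) \<le> N u" using N_triangle[of u w] assms w by simp
  moreover have "N u \<le> N (u + w)"
    using N_triangle[of "u + w" "- w"] assms w by (simp add: F_closed N_minus)
  ultimately show ?thesis using assms w by (simp add: E_eq_N_powr F_add)
qed

text \<open>\<open>N\<close> is convex along the line by the triangle inequality and homogeneity,
  and the p-th power is convex and increasing on the half-line.\<close>

lemma convex_on_line: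
  assumes "u \<in> F" "v \<in> F"
  shows "convex_on UNIV (\<lambda>t. E (u + t *\<^sub>f v))"
proof (rule convex_onI)
  fix t x y :: real
  assume t: "0 < t" "t < 1"
  define a b where "a = u + x *\<^sub>f v" and "b = u + y *\<^sub>f v"
  have ab: "a \<in> F" "b \<in> F" using assms by (auto simp: a_def b_def F_closed)
  have eq: "u + ((1 - t) *\<^sub>R x + t *\<^sub>R y) *\<^sub>f v = (1 - t) *\<^sub>f a + t *\<^sub>f b"
    by (simp add: a_def b_def fscale_def fun_eq_iff algebra_simps)
  have "N ((1 - t) *\<^sub>f a + t *\<^sub>f b) \<le> (1 - t) * N a + t * N b"
    using N_triangle[of "(1 - t) *\<^sub>f a" "t *\<^sub>f b"] ab t by (simp add: F_scale N_scale)
  then have "N ((1 - t) *\<^sub>f a + t *\<^sub>f b) powr p \<le> ((1 - t) * N a + t * N b) powr p"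
    using p_gt_1 by (intro powr_mono2) (auto simp: N_nonneg)
  also have "\<dots> \<le> (1 - t) * N a powr p + t * N b powr p"
    using convex_onD[OF convex_on_powr_nonneg, of p t "N a" "N b"] p_gt_1 t by (simp add: N_nonneg)
  finally have "N ((1 - t) *\<^sub>f a + t *\<^sub>f b) powr p \<le> (1 - t) * N a powr p + t * N b powr p" .
  then show "E (u + ((1 - t) *\<^sub>R x + t *\<^sub>R y) *\<^sub>f v) \<le> (1 - t) * E (u + x *\<^sub>f v) + t * E (u + y *\<^sub>f v)"
    unfolding eq using ab by (simp add: E_eq_N_powr F_closed flip: a_def b_def)
qed auto

section \<open>Transfer of the two-point inequalities to the form by the contraction
  property\<close>

lemma linear_contraction:
  fixes a b c d q r :: real
  assumes qr: "0 < q" "q \<le> p" "p \<le> r"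
    and bound: "\<And>x y. (\<bar>a * x + b * y\<bar> powr r + \<bar>c * x + d * y\<bar> powr r) powr (1 / r)
                  \<le> (\<bar>x\<bar> powr q + \<bar>y\<bar> powr q) powr (1 / q)"
    and uv: "u \<in> F" "v \<in> F"
  shows "(N (a *\<^sub>f u + b *\<^sub>f v) powr r + N (c *\<^sub>f u + d *\<^sub>f v) powr r) powr (1 / r)
    \<le> (N u powr q + N v powr q) powr (1 / q)"
proof -
  \<comment> \<open>RF5 is used with m = n = 2. As \<open>T\<close> is linear, its Lipschitz
    condition is the operator bound \<open>bound\<close> applied to the difference of the two
    arguments.\<close>
  define T where "T z k = (if k = 0 then a * z 0 + b * z 1 else c * z 0 + d * z 1)"
    for z :: "nat \<Rightarrow> real" and k :: nat
  define w where "w j = (if j = 0 then u else v)" for j :: nat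
  have ell: "ell_norm (ereal s) 2 z = (\<bar>z 0\<bar> powr s + \<bar>z 1\<bar> powr s) powr (1 / s)" for s z
    by (simp add: ell_norm_def numeral_2_eq_2)
  have "generalized_contraction q (ereal r) 2 2 T"
    unfolding generalized_contraction_def ell
  proof (intro conjI allI impI)
    fix x y :: "nat \<Rightarrow> real"
    have "T x 0 - T y 0 = a * (x 0 - y 0) + b * (x 1 - y 1)"
      "T x 1 - T y 1 = c * (x 0 - y 0) + d * (x 1 - y 1)"
      by (simp_all add: T_def algebra_simps)
    then show "(\<bar>T x 0 - T y 0\<bar> powr r + \<bar>T x 1 - T y 1\<bar> powr r) powr (1 / r)
        \<le> (\<bar>x 0 - y 0\<bar> powr q + \<bar>x 1 - y 1\<bar> powr q) powr (1 / q)"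
      using bound by simp
  qed (simp add: T_def)
  then have "ell_norm (ereal r) 2 (\<lambda>k. E (\<lambda>x. T (\<lambda>j. w j x) k) powr (1 / p))
      \<le> ell_norm (ereal q) 2 (\<lambda>j. E (w j) powr (1 / p))"
    using RF5[of q "ereal r" 2 2 T w] qr uv by (simp add: w_def)
  moreover have "(\<lambda>x. T (\<lambda>j. w j x) 0) = a *\<^sub>f u + b *\<^sub>f v" "(\<lambda>x. T (\<lambda>j. w j x) 1) = c *\<^sub>f u + d *\<^sub>f v"
    by (simp_all add: T_def w_def fscale_def fun_eq_iff)
  ultimately show ?thesis
    unfolding ell by (simp add: w_def N_def)
qed

text \<open>The scalar inequality says that a multiple of (x, y) \<mapsto> (x + y / \<kappa>, x - y
  / \<kappa>) is a contraction from the q-norm to the p-norm. Here \<mu> absorbs the factor 2 and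
  \<kappa> the weight c; the contraction is applied to u and
  \<open>\<kappa> *\<^sub>f v\<close>.\<close>

lemma two_point_smooth_transfer:
  fixes c q :: real
  assumes "0 < q" "q \<le> p" "0 < c"
    and scalar: "\<And>x y :: real. \<bar>x + y\<bar> powr p + \<bar>x - y\<bar> powr p \<le> 2 * (\<bar>x\<bar> powr q + c * \<bar>y\<bar> powr q) powr (p / q)"
    and uv: "u \<in> F" "v \<in> F"
  shows "E (u + v) + E (u - v) \<le> 2 * (N u powr q + c * N v powr q) powr (p / q)"
proof -
  define \<mu> \<kappa> where "\<mu> = (1 / 2) powr (1 / p)" and "\<kappa> = c powr (1 / q)"
  have pos: "0 < \<mu>" "0 < \<kappa>" "\<mu> powr p = 1 / 2" "\<kappa> powr q = c"
    using assms p_gt_1 by (auto simp: \<mu>_def \<kappa>_def powr_powr)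
  have bound: "(\<bar>\<mu> * x + \<mu> / \<kappa> * y\<bar> powr p + \<bar>\<mu> * x + (- \<mu> / \<kappa>) * y\<bar> powr p) powr (1 / p)
    \<le> (\<bar>x\<bar> powr q + \<bar>y\<bar> powr q) powr (1 / q)" for x y
  proof -
    have "\<mu> * x + \<mu> / \<kappa> * y = \<mu> * (x + y / \<kappa>)" "\<mu> * x + (- \<mu> / \<kappa>) * y = \<mu> * (x - y / \<kappa>)"
      by (simp_all add: algebra_simps)
    then have "\<bar>\<mu> * x + \<mu> / \<kappa> * y\<bar> powr p + \<bar>\<mu> * x + (- \<mu> / \<kappa>) * y\<bar> powr p
        = (\<bar>x + y / \<kappa>\<bar> powr p + \<bar>x - y / \<kappa>\<bar> powr p) / 2"
      using pos(1) by (simp only: abs_mult powr_mult abs_of_pos) (simp add: pos(3) add_divide_distrib)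
    also have "\<dots> \<le> (\<bar>x\<bar> powr q + c * \<bar>y / \<kappa>\<bar> powr q) powr (p / q)"
      using scalar[of x "y / \<kappa>"] by simp
    also have "c * \<bar>y / \<kappa>\<bar> powr q = \<bar>y\<bar> powr q"
      using pos assms by (simp add: abs_divide powr_divide)
    finally have "(\<bar>\<mu> * x + \<mu> / \<kappa> * y\<bar> powr p + \<bar>\<mu> * x + (- \<mu> / \<kappa>) * y\<bar> powr p) powr (1 / p)
        \<le> ((\<bar>x\<bar> powr q + \<bar>y\<bar> powr q) powr (p / q)) powr (1 / p)"
      using p_gt_1 by (intro powr_mono2) auto
    then show ?thesis using p_gt_1 by (simp add: powr_powr)
  qed
  have "(N (\<mu> *\<^sub>f u + (\<mu> / \<kappa>) *\<^sub>f (\<kappa> *\<^sub>f v)) powr p + N (\<mu> *\<^sub>f u + (- \<mu> / \<kappa>) *\<^sub>f (\<kappa> *\<^sub>f v)) powr p) powr (1 / p)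
    \<le> (N u powr q + N (\<kappa> *\<^sub>f v) powr q) powr (1 / q)" (is "?lhs powr _ \<le> _")
    using assms p_gt_1 by (intro linear_contraction bound F_scale) auto
  then have "(?lhs powr (1 / p)) powr p \<le> ((N u powr q + N (\<kappa> *\<^sub>f v) powr q) powr (1 / q)) powr p"
    using p_gt_1 by (intro powr_mono2) auto
  then have "?lhs \<le> (N u powr q + N (\<kappa> *\<^sub>f v) powr q) powr (p / q)"
    using p_gt_1 by (simp add: powr_powr)
  moreover have "\<mu> *\<^sub>f u + (\<mu> / \<kappa>) *\<^sub>f (\<kappa> *\<^sub>f v) = \<mu> *\<^sub>f (u + v)"
      "\<mu> *\<^sub>f u + (- \<mu> / \<kappa>) *\<^sub>f (\<kappa> *\<^sub>f v) = \<mu> *\<^sub>f (u - v)"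
    using pos by (simp_all add: fscale_def fun_eq_iff algebra_simps)
  ultimately show ?thesis
    using pos(1,2,4) uv by (simp add: pos(3) N_scale F_closed powr_mult N_nonneg E_eq_N_powr)
qed

text \<open>Here the inverse map, from the p-norm to the r-norm, is applied to the pair u + v, u -
  v, from which it recovers multiples of u and v.\<close>

lemma two_point_convex_transfer:
  fixes c r :: real
  assumes "p \<le> r" "0 < c"
    and scalar: "\<And>x y :: real. (\<bar>x\<bar> powr r + c * \<bar>y\<bar> powr r) powr (p / r) \<le> (\<bar>x + y\<bar> powr p + \<bar>x - y\<bar> powr p) / 2"
    and uv: "u \<in> F" "v \<in> F"
  shows "(N u powr r + c * N v powr r) powr (p / r) \<le> (E (u + v) + E (u - v)) / 2"
proof -
  define \<mu> \<kappa> where "\<mu> = 2 powr (1 / p)" and "\<kappa> = c powr (1 / r)"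
  have r: "0 < r" using assms p_gt_1 by simp
  have pos: "0 < \<mu>" "0 < \<kappa>" "\<mu> powr p = 2" "\<kappa> powr r = c"
    using assms p_gt_1 r by (auto simp: \<mu>_def \<kappa>_def powr_powr)
  define a b where "a = \<mu> / 2" and "b = \<kappa> * \<mu> / 2"
  have bound: "(\<bar>a * x + a * y\<bar> powr r + \<bar>b * x + (- b) * y\<bar> powr r) powr (1 / r)
    \<le> (\<bar>x\<bar> powr p + \<bar>y\<bar> powr p) powr (1 / p)" for x y
  proof -
    \<comment> \<open>In half-sum and half-difference coordinates the required contraction bound
      becomes the scalar hypothesis.\<close>
    define X Y where "X = (x + y) / 2" and "Y = (x - y) / 2"
    have XY: "X + Y = x" "X - Y = y" by (simp_all add: X_def Y_def field_simps)
    have "a * x + a * y = \<mu> * X" "b * x + (- b) * y = \<mu> * (\<kappa> * Y)"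
      by (simp_all add: a_def b_def X_def Y_def algebra_simps diff_divide_distrib add_divide_distrib)
    then have "\<bar>a * x + a * y\<bar> powr r + \<bar>b * x + (- b) * y\<bar> powr r = \<mu> powr r * (\<bar>X\<bar> powr r + c * \<bar>Y\<bar> powr r)"
      using pos by (simp only: abs_mult powr_mult) (simp add: algebra_simps)
    then have "(\<bar>a * x + a * y\<bar> powr r + \<bar>b * x + (- b) * y\<bar> powr r) powr (1 / r)
        = \<mu> * (\<bar>X\<bar> powr r + c * \<bar>Y\<bar> powr r) powr (1 / r)"
      using pos r assms by (simp add: powr_mult powr_powr)
    also have "\<dots> = \<mu> * ((\<bar>X\<bar> powr r + c * \<bar>Y\<bar> powr r) powr (p / r)) powr (1 / p)"
      using p_gt_1 by (simp add: powr_powr)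
    also have "\<dots> \<le> \<mu> * ((\<bar>x\<bar> powr p + \<bar>y\<bar> powr p) / 2) powr (1 / p)"
      using scalar[of X Y] pos p_gt_1 by (intro mult_left_mono powr_mono2) (auto simp: XY)
    also have "\<dots> = (\<bar>x\<bar> powr p + \<bar>y\<bar> powr p) powr (1 / p)"
      by (simp add: \<mu>_def powr_divide)
    finally show ?thesis .
  qed
  have "(N (a *\<^sub>f (u + v) + a *\<^sub>f (u - v)) powr r + N (b *\<^sub>f (u + v) + (- b) *\<^sub>f (u - v)) powr r) powr (1 / r)
    \<le> (N (u + v) powr p + N (u - v) powr p) powr (1 / p)"
    using assms p_gt_1 by (intro linear_contraction bound F_closed) auto
  moreover have "a *\<^sub>f (u + v) + a *\<^sub>f (u - v) = \<mu> *\<^sub>f u" "b *\<^sub>f (u + v) + (- b) *\<^sub>f (u - v) = \<mu> *\<^sub>f (\<kappa> *\<^sub>f v)"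
    by (simp_all add: a_def b_def fscale_def fun_eq_iff field_simps)
  ultimately have "(\<mu> powr r * (N u powr r + c * N v powr r)) powr (1 / r)
      \<le> (N (u + v) powr p + N (u - v) powr p) powr (1 / p)"
    using pos uv by (simp add: N_scale F_closed powr_mult N_nonneg algebra_simps)
  then have "\<mu> * (N u powr r + c * N v powr r) powr (1 / r) \<le> (E (u + v) + E (u - v)) powr (1 / p)"
    using pos r uv assms by (simp add: powr_mult powr_powr E_eq_N_powr F_closed)
  then have "(\<mu> * (N u powr r + c * N v powr r) powr (1 / r)) powr p \<le> ((E (u + v) + E (u - v)) powr (1 / p)) powr p"
    using pos p_gt_1 by (intro powr_mono2) auto
  then show ?thesis
    using pos p_gt_1 uv by (simp add: powr_mult powr_powr E_nonneg F_closed)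
qed

text \<open>Strictness comes from the extra term \<open>c * N v powr r\<close>, positive because v
  is not constant. The exponent r is 2 for p \<le> 2 and p otherwise.\<close>

lemma E_strict_convex:
  assumes "u \<in> F" "v \<in> F" "v \<notin> const_funs"
  shows "2 * E u < E (u + v) + E (u - v)"
proof -
  obtain r c :: real where r: "p \<le> r" "0 < c"
    and le: "(N u powr r + c * N v powr r) powr (p / r) \<le> (E (u + v) + E (u - v)) / 2"
  proof (cases "p \<le> 2")
    case True
    show thesis
      using True p_gt_1 assms two_point_convex_le2
      by (intro that[of 2 "(p - 1) / (2 * p)"] two_point_convex_transfer) auto
  next
    case False
    show thesis
      using False p_gt_1 assms two_point_convex_ge2[of p]
      by (intro that[of p 1] two_point_convex_transfer) auto
  qed
  have "N u powr r < N u powr r + c * N v powr r"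
    using r assms N_pos_iff[of v] by simp
  then have "(N u powr r) powr (p / r) < (N u powr r + c * N v powr r) powr (p / r)"
    using r p_gt_1 by (intro powr_less_mono2) auto
  with le show ?thesis
    using assms r p_gt_1 by (simp add: powr_powr E_eq_N_powr)
qed

section \<open>Second differences and differentiability along lines\<close>

definition smooth_exponent :: real
  where "smooth_exponent = min p 2"

text \<open>The weight that goes with \<open>smooth_exponent\<close> in the scalar smoothness
  inequality: \<open>two_point_smooth_le2\<close> has weight 1, \<open>two_point_smooth_ge2\<close>
  has weight 2 * p. The pair lets both ranges of p share one estimate.\<close>

definition smooth_constant :: real
  where "smooth_constant = (if p \<le> 2 then 1 else 2 * p)"

lemma smooth_params: "1 < smooth_exponent" "smooth_exponent \<le> p" "0 < smooth_constant"
  using p_gt_1 by (auto simp: smooth_exponent_def smooth_constant_def)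

text \<open>With q the smoothness exponent, E u is the power p / q of \<open>N u powr q\<close>. So
  the second difference is at most twice an increment of this power function, which
  \<open>powr_diff_le\<close> bounds by the slope at the upper end.\<close>

lemma second_difference_le:
  assumes "u \<in> F" "v \<in> F"
  shows "E (u + v) + E (u - v) - 2 * E u
    \<le> 2 * (p / smooth_exponent) * smooth_constant * (N u powr smooth_exponent + smooth_constant * N v powr smooth_exponent) powr (p / smooth_exponent - 1) * N v powr smooth_exponent"
proof -
  let ?q = smooth_exponent and ?c = smooth_constant
  have "E (u + v) + E (u - v) \<le> 2 * (N u powr ?q + ?c * N v powr ?q) powr (p / ?q)"
    using smooth_params p_gt_1 assms two_point_smooth_le2[of p] two_point_smooth_ge2[of p]
    by (intro two_point_smooth_transfer) (auto simp: smooth_exponent_def smooth_constant_def min_def)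
  moreover have "E u = (N u powr ?q) powr (p / ?q)"
    using assms smooth_params by (simp add: powr_powr E_eq_N_powr)
  moreover have "(N u powr ?q + ?c * N v powr ?q) powr (p / ?q) - (N u powr ?q) powr (p / ?q)
      \<le> p / ?q * (N u powr ?q + ?c * N v powr ?q) powr (p / ?q - 1) * (?c * N v powr ?q)"
    using powr_diff_le[of "N u powr ?q" "N u powr ?q + ?c * N v powr ?q" "p / ?q"] smooth_params by simp
  ultimately have "E (u + v) + E (u - v) - 2 * E u
      \<le> 2 * (p / ?q * (N u powr ?q + ?c * N v powr ?q) powr (p / ?q - 1) * (?c * N v powr ?q))"
    by linarith
  then show ?thesis by (simp only: mult_ac)
qed

text \<open>The smoothness exponent q exceeds 1, so \<open>N h powr q\<close> is o(N h), while the
  other factor stays bounded for N h \<le> 1.\<close>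

lemma second_difference_small:
  assumes "u \<in> F" "0 < \<epsilon>"
  obtains \<delta> where "0 < \<delta>" "\<And>h. h \<in> F \<Longrightarrow> N h < \<delta> \<Longrightarrow> E (u + h) + E (u - h) - 2 * E u \<le> \<epsilon> * N h"
proof -
  let ?q = smooth_exponent and ?c = smooth_constant
  define K where "K = 2 * (p / ?q) * ?c * (N u powr ?q + ?c) powr (p / ?q - 1)"
  have K: "0 \<le> K" using smooth_params p_gt_1 by (simp add: K_def)
  \<comment> \<open>The second entry solves (K + 1) * \<open>\<delta> powr (q - 1)\<close> =
    \<epsilon>, with q the smoothness exponent; K + 1 rather than K keeps the divisor
    positive.\<close>
  define \<delta> where "\<delta> = min 1 ((\<epsilon> / (K + 1)) powr (1 / (?q - 1)))"
  have "E (u + h) + E (u - h) - 2 * E u \<le> \<epsilon> * N h" if h: "h \<in> F" "N h < \<delta>" for h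
  proof -
    have "N h powr ?q \<le> 1"
      using h smooth_params by (intro powr_le1) (auto simp: \<delta>_def N_nonneg)
    then have "(N u powr ?q + ?c * N h powr ?q) powr (p / ?q - 1) \<le> (N u powr ?q + ?c) powr (p / ?q - 1)"
      using smooth_params by (intro powr_mono2) (auto simp: mult_le_cancel_left1)
    then have "2 * (p / ?q) * ?c * (N u powr ?q + ?c * N h powr ?q) powr (p / ?q - 1) * N h powr ?q \<le> K * N h powr ?q"
      unfolding K_def using smooth_params p_gt_1 by (intro mult_right_mono mult_left_mono) auto
    then have "E (u + h) + E (u - h) - 2 * E u \<le> K * N h powr ?q"
      using second_difference_le[OF assms(1) h(1)] by linarith
    also have "N h powr ?q = N h * N h powr (?q - 1)"
      using N_nonneg[of h] smooth_params by (cases "N h = 0") (simp_all add: powr_mult_base)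
    also have "K * (N h * N h powr (?q - 1)) \<le> (K + 1) * (N h * (\<epsilon> / (K + 1)))"
    proof (intro mult_mono order_refl)
      have "N h powr (?q - 1) \<le> ((\<epsilon> / (K + 1)) powr (1 / (?q - 1))) powr (?q - 1)"
        using h smooth_params by (intro powr_mono2) (auto simp: N_nonneg \<delta>_def)
      then show "N h powr (?q - 1) \<le> \<epsilon> / (K + 1)"
        using smooth_params K assms by (simp add: powr_powr)
    qed (use K N_nonneg in auto)
    also have "\<dots> = \<epsilon> * N h" using K by (simp add: field_simps)
    finally show ?thesis .
  qed
  moreover have "0 < \<delta>" using K assms by (simp add: \<delta>_def)
  ultimately show thesis by (rule that[rotated])
qed

abbreviation e :: "('a \<Rightarrow> real) \<Rightarrow> ('a \<Rightarrow> real) \<Rightarrow> real"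
  where "e \<equiv> form_deriv p E"

text \<open>Along the line E is convex with second differences o(t), so the supporting slope at 0 is
  the derivative. The supporting line at t = 1 is the tangent inequality.\<close>

lemma has_derivative_and_tangent:
  assumes "u \<in> F" "v \<in> F"
  shows E_has_derivative: "((\<lambda>t. E (u + t *\<^sub>f v)) has_real_derivative p * e u v) (at 0)"
    and E_tangent: "E u + p * e u v \<le> E (u + v)"
proof -
  let ?f = "\<lambda>t. E (u + t *\<^sub>f v)"
  have "\<exists>\<delta>>0. \<forall>t. \<bar>t\<bar> < \<delta> \<longrightarrow> ?f t + ?f (- t) - 2 * ?f 0 \<le> \<epsilon> * \<bar>t\<bar>" if "0 < \<epsilon>" for \<epsilon>
  proof -
    \<comment> \<open>N v + 1 is used as divisor because N v vanishes for constant v.\<close>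
    from that
    have "0 < \<epsilon> / (N v + 1)" using N_nonneg[of v] by simp
    then obtain \<delta> where \<delta>: "0 < \<delta>"
      "\<And>h. h \<in> F \<Longrightarrow> N h < \<delta> \<Longrightarrow> E (u + h) + E (u - h) - 2 * E u \<le> \<epsilon> / (N v + 1) * N h"
      using second_difference_small[OF assms(1)] by blast
    show "\<exists>\<delta>>0. \<forall>t. \<bar>t\<bar> < \<delta> \<longrightarrow> ?f t + ?f (- t) - 2 * ?f 0 \<le> \<epsilon> * \<bar>t\<bar>"
    proof (intro exI[of _ "\<delta> / (N v + 1)"] conjI allI impI)
      show "0 < \<delta> / (N v + 1)" using \<delta>(1) N_nonneg[of v] by simp
      fix t :: real
      assume "\<bar>t\<bar> < \<delta> / (N v + 1)"
      then have "\<bar>t\<bar> * (N v + 1) < \<delta>" using N_nonneg[of v] by (simp add: less_divide_eq)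
      then have "N (t *\<^sub>f v) < \<delta>" using assms by (simp add: N_scale algebra_simps)
      then have "?f t + ?f (- t) - 2 * ?f 0 \<le> \<epsilon> / (N v + 1) * N (t *\<^sub>f v)"
        using \<delta>(2)[of "t *\<^sub>f v"] assms by (simp add: F_scale)
      also have "\<dots> = \<epsilon> * \<bar>t\<bar> * (N v / (N v + 1))" using assms by (simp add: N_scale)
      also have "\<dots> \<le> \<epsilon> * \<bar>t\<bar> * 1"
        using N_nonneg[of v] \<open>0 < \<epsilon>\<close> by (intro mult_left_mono) auto
      finally show "?f t + ?f (- t) - 2 * ?f 0 \<le> \<epsilon> * \<bar>t\<bar>" by simp
    qed
  qed
  then obtain m where m: "(?f has_real_derivative m) (at 0)" "\<And>t. ?f 0 + m * t \<le> ?f t"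
    using convex_differentiable_at_0[OF convex_on_line[OF assms]] by blast
  have "p * e u v = m"
    using DERIV_imp_deriv[OF m(1)] p_gt_1 by (simp add: form_deriv_def)
  then show "(?f has_real_derivative p * e u v) (at 0)" "E u + p * e u v \<le> E (u + v)"
    using m(1) m(2)[of 1] by auto
qed

subsection \<open>The derivative\<close>

lemma deriv_eqI:
  assumes "((\<lambda>t. E (u + t *\<^sub>f v)) has_real_derivative D) (at 0)"
  shows "e u v = D / p"
  using DERIV_imp_deriv[OF assms] by (simp add: form_deriv_def)

lemma E_midpoint:
  assumes "u \<in> F" "v \<in> F"
  shows "2 * E u \<le> E (u + v) + E (u - v)"
proof (cases "v \<in> const_funs")
  case True
  have "E (u - v + v) = E (u - v)" using assms True by (intro E_add_const F_diff)
  then show ?thesis using assms True by (simp add: E_add_const)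
qed (use E_strict_convex assms in force)

lemma deriv_scale_right:
  assumes "u \<in> F" "v \<in> F"
  shows "e u (c *\<^sub>f v) = c * e u v"
proof -
  have "((\<lambda>t. E (u + (t * c) *\<^sub>f v)) has_real_derivative p * e u v * c) (at 0)"
  proof (rule DERIV_chain2[where f = "\<lambda>t. E (u + t *\<^sub>f v)"])
    show "((\<lambda>t. E (u + t *\<^sub>f v)) has_real_derivative p * e u v) (at (0 * c))"
      using E_has_derivative[OF assms] by simp
  qed (auto intro!: derivative_eq_intros)
  then have "((\<lambda>t. E (u + t *\<^sub>f (c *\<^sub>f v))) has_real_derivative p * e u v * c) (at 0)"
    by simp
  from deriv_eqI[OF this] show ?thesis using p_gt_1 by simp
qed

text \<open>The midpoint inequality below has equality at \<open>t = 0\<close>, hence equal derivatives there.\<close>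

lemma deriv_add_right:
  assumes "u \<in> F" "v \<in> F" "w \<in> F"
  shows "e u (v + w) = e u v + e u w"
proof -
  define \<phi> where "\<phi> t = E (u + t *\<^sub>f (2 *\<^sub>f v)) + E (u + t *\<^sub>f (2 *\<^sub>f w)) - 2 * E (u + t *\<^sub>f (v + w))" for t
  have "(\<phi> has_real_derivative p * e u (2 *\<^sub>f v) + p * e u (2 *\<^sub>f w) - 2 * (p * e u (v + w))) (at 0)"
    unfolding \<phi>_def using assms
    by (intro DERIV_diff DERIV_add DERIV_cmult E_has_derivative F_closed)
  moreover have "\<phi> 0 \<le> \<phi> t" for t
  proof -
    have eqs: "u + t *\<^sub>f (v + w) + t *\<^sub>f (v - w) = u + t *\<^sub>f (2 *\<^sub>f v)"
      "u + t *\<^sub>f (v + w) - t *\<^sub>f (v - w) = u + t *\<^sub>f (2 *\<^sub>f w)"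
      by (simp_all add: fscale_def fun_eq_iff algebra_simps)
    have "2 * E (u + t *\<^sub>f (v + w)) \<le> E (u + t *\<^sub>f (2 *\<^sub>f v)) + E (u + t *\<^sub>f (2 *\<^sub>f w))"
      using E_midpoint[of "u + t *\<^sub>f (v + w)" "t *\<^sub>f (v - w)"] assms
      unfolding eqs by (simp add: F_closed)
    then show ?thesis by (simp add: \<phi>_def)
  qed
  ultimately have "p * e u (2 *\<^sub>f v) + p * e u (2 *\<^sub>f w) - 2 * (p * e u (v + w)) = 0"
    by (intro DERIV_local_min[of \<phi> _ 0 1]) auto
  then have "p * (2 * e u v + 2 * e u w - 2 * e u (v + w)) = 0"
    using assms by (simp add: deriv_scale_right algebra_simps)
  then show ?thesis using p_gt_1 by simp
qed

lemma deriv_minus_right: "u \<in> F \<Longrightarrow> v \<in> F \<Longrightarrow> e u (- v) = - e u v"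
  using deriv_scale_right[of u v "-1"] by simp

lemma deriv_linear:
  assumes "u \<in> F"
  shows "linear_functional_on F (+) (*\<^sub>f) (e u)"
  using assms by (simp add: linear_functional_on_def deriv_add_right deriv_scale_right)

lemma deriv_self:
  assumes "u \<in> F"
  shows "e u u = E u"
proof -
  have "((\<lambda>t. (1 + t) powr p * E u) has_real_derivative p * E u) (at 0)"
    by (auto intro!: derivative_eq_intros)
  then have "((\<lambda>t. E (u + t *\<^sub>f u)) has_real_derivative p * E u) (at 0)"
  \<comment> \<open>For t > -1 the factor 1 + t is positive, so homogeneity gives its power without
    absolute value.\<close>
  proof (rule has_field_derivative_transform_within_open[where S = "{-1<..}"])
    fix t :: real
    assume t: "t \<in> {-1<..}"
    have "u + t *\<^sub>f u = (1 + t) *\<^sub>f u" by (simp add: fscale_def fun_eq_iff algebra_simps)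
    then show "(1 + t) powr p * E u = E (u + t *\<^sub>f u)"
      using t assms by (simp add: E_scale)
  qed auto
  from deriv_eqI[OF this] show ?thesis using p_gt_1 by simp
qed

lemma deriv_const_right:
  assumes "u \<in> F" "v \<in> const_funs"
  shows "e u v = 0"
  using deriv_eqI[of u v 0] assms by (simp add: E_add_const scale_const)

lemma deriv_add_const_left:
  assumes "u \<in> F" "v \<in> F" "w \<in> const_funs"
  shows "e (u + w) v = e u v"
proof -
  have "E (u + w + t *\<^sub>f v) = E (u + t *\<^sub>f v)" for t
    using E_add_const[of "u + t *\<^sub>f v" w] assms by (simp add: F_closed add_ac)
  then show ?thesis by (simp add: form_deriv_def)
qed

text \<open>For nonzero a, pull a out of E and rescale the direction by 1 / a. At a = 0 the right
  side vanishes since sgn 0 = 0, and the left side is the derivative at 0 of a multiple of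
  \<open>\<bar>t\<bar> powr p\<close>, where p > 1.\<close>

lemma deriv_scale_left:
  assumes "u \<in> F" "v \<in> F"
  shows "e (a *\<^sub>f u) v = sgn a * \<bar>a\<bar> powr (p - 1) * e u v"
proof (cases "a = 0")
  case True
  have "e 0 v = 0"
  proof (rule trans[OF deriv_eqI])
    have "E (0 + t *\<^sub>f v) = \<bar>t\<bar> powr p * E v" for t
      using assms by (simp add: E_scale)
    moreover have "((\<lambda>t. \<bar>t\<bar> powr p * E v) has_real_derivative 0) (at 0)"
    proof -
      have "((\<lambda>t::real. \<bar>t\<bar> powr (p - 1) * E v) \<longlongrightarrow> 0 powr (p - 1) * E v) (at 0)"
        using p_gt_1 by (intro tendsto_intros tendsto_powr' tendsto_rabs_zero) auto
      then have "((\<lambda>t::real. \<bar>t\<bar> powr (p - 1) * E v) \<longlongrightarrow> 0) (at 0)" by simp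
      moreover have "eventually (\<lambda>t. norm ((\<bar>0 + t\<bar> powr p * E v - \<bar>0\<bar> powr p * E v) / t) \<le> \<bar>t\<bar> powr (p - 1) * E v) (at (0::real))"
      proof (rule eventually_at_topological[THEN iffD2, OF exI[of _ UNIV]], safe)
        fix t :: real
        assume "t \<noteq> 0"
        then have "\<bar>t\<bar> powr p = \<bar>t\<bar> * \<bar>t\<bar> powr (p - 1)" by (simp add: powr_mult_base)
        then show "norm ((\<bar>0 + t\<bar> powr p * E v - \<bar>0\<bar> powr p * E v) / t) \<le> \<bar>t\<bar> powr (p - 1) * E v"
          using \<open>t \<noteq> 0\<close> assms by (simp add: abs_mult abs_divide E_nonneg)
      qed auto
      ultimately show ?thesis
        unfolding DERIV_def by (rule Lim_null_comparison[rotated])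
    qed
    ultimately show "((\<lambda>t. E (0 + t *\<^sub>f v)) has_real_derivative 0) (at 0)"
      by simp
  qed simp
  then show ?thesis using True by simp
next
  case False
  have "((\<lambda>t. \<bar>a\<bar> powr p * E (u + t *\<^sub>f ((1 / a) *\<^sub>f v))) has_real_derivative \<bar>a\<bar> powr p * (p * e u ((1 / a) *\<^sub>f v))) (at 0)"
    using assms by (intro DERIV_cmult E_has_derivative F_closed)
  moreover have "\<bar>a\<bar> powr p * E (u + t *\<^sub>f ((1 / a) *\<^sub>f v)) = E (a *\<^sub>f u + t *\<^sub>f v)" for t
  proof -
    have "a *\<^sub>f u + t *\<^sub>f v = a *\<^sub>f (u + t *\<^sub>f ((1 / a) *\<^sub>f v))"
      using False by (simp add: fscale_def fun_eq_iff algebra_simps)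
    then show ?thesis using assms by (simp only: E_scale F_closed)
  qed
  ultimately have "((\<lambda>t. E (a *\<^sub>f u + t *\<^sub>f v)) has_real_derivative \<bar>a\<bar> powr p * (p * e u ((1 / a) *\<^sub>f v))) (at 0)"
    by simp
  from deriv_eqI[OF this] have "e (a *\<^sub>f u) v = \<bar>a\<bar> powr p / a * e u v"
    using assms p_gt_1 by (simp add: deriv_scale_right)
  also have "\<bar>a\<bar> powr p = \<bar>a\<bar> * \<bar>a\<bar> powr (p - 1)" using False by (simp add: powr_mult_base)
  also have "\<bar>a\<bar> * \<bar>a\<bar> powr (p - 1) / a = sgn a * \<bar>a\<bar> powr (p - 1)"
    using False by (simp add: sgn_if)
  finally show ?thesis .
qed

text \<open>Scale the direction w so that \<open>s *\<^sub>f w\<close> has the same norm as u. The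
  tangent inequality from u to this point then has equal energies on both sides and leaves s * e u w
  \<le> E u; use it for v and -v.\<close>

lemma deriv_le:
  assumes u: "u \<in> F" and v: "v \<in> F"
  shows "\<bar>e u v\<bar> \<le> N u powr (p - 1) * N v"
proof (cases "N u = 0 \<or> N v = 0")
  case True
  have "u \<in> const_funs \<or> v \<in> const_funs"
    using True N_pos_iff[OF u] N_pos_iff[OF v] by auto
  \<comment> \<open>A constant u is the zero function plus a constant; zero is written as
    \<open>0 *\<^sub>f u\<close> so that \<open>deriv_scale_left\<close> applies.\<close>
  moreover have "e u v = 0" if "u \<in> const_funs"
  proof -
    have "e (0 *\<^sub>f u + u) v = e (0 *\<^sub>f u) v"
      using that assms by (intro deriv_add_const_left F_scale)
    then have "e u v = e (0 *\<^sub>f u) v" by simp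
    also have "\<dots> = 0" using deriv_scale_left[OF assms, of 0] by simp
    finally show ?thesis .
  qed
  moreover have "e u v = 0" if "v \<in> const_funs"
    using that u by (rule deriv_const_right[rotated])
  ultimately show ?thesis by (auto simp: N_nonneg)
next
  case False
  then have pos: "0 < N u" "0 < N v" using N_nonneg[of u] N_nonneg[of v] by auto
  have bound: "e u w \<le> N u powr (p - 1) * N v" if w: "w \<in> F" "N w = N v" for w
  proof -
    define s where "s = N u / N v"
    have s: "0 < s" using pos by (simp add: s_def)
    have "E u + p * e u (s *\<^sub>f w - u) \<le> E (s *\<^sub>f w)"
      using E_tangent[OF u, of "s *\<^sub>f w - u"] u w by (simp add: F_closed)
    moreover have "e u (s *\<^sub>f w - u) = s * e u w - E u"
      using deriv_add_right[OF u, of "s *\<^sub>f w" "- u"] u w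
      by (simp add: F_closed deriv_scale_right deriv_minus_right deriv_self)
    moreover have "E (s *\<^sub>f w) = E u"
      using u w s pos by (simp add: E_eq_N_powr F_closed N_scale s_def)
    ultimately have "p * (s * e u w) \<le> p * E u" by (simp add: algebra_simps)
    then have "s * e u w \<le> E u" using p_gt_1 by simp
    also have "E u = s * (N u powr (p - 1) * N v)"
      using pos u by (simp add: E_eq_N_powr s_def powr_mult_base)
    finally show ?thesis using s by simp
  qed
  show ?thesis
    using bound[of v] bound[of "- v"] u v by (simp add: F_closed N_minus deriv_minus_right)
qed

section \<open>Remainder, strict monotonicity and Hoelder continuity of the derivative\<close>

lemma E_remainder_le:
  assumes "u \<in> F" "h \<in> F"
  shows "E (u + h) \<le> E u + p * e u h + (E (u + h) + E (u - h) - 2 * E u)"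
proof -
  \<comment> \<open>The tangent at u is a lower bound at u - h as well, so the second difference
    dominates the remainder at u + h.\<close>
  have "E u + p * e u (- h) \<le> E (u + - h)" using assms by (intro E_tangent F_minus)
  then show ?thesis using assms by (simp add: deriv_minus_right)
qed

text \<open>The tangent at \<open>u\<^sub>1\<close> is evaluated at
  \<open>u\<^sub>1 + h = u\<^sub>2 + k\<close>, and the tangent at \<open>u\<^sub>2\<close> at
  \<open>u\<^sub>1\<close>. Adding the two leaves the remainder of E at \<open>u\<^sub>2\<close>
  with increment k.\<close>

lemma deriv_diff_le:
  assumes "u\<^sub>1 \<in> F" "u\<^sub>2 \<in> F" "h \<in> F"
  defines "k \<equiv> u\<^sub>1 - u\<^sub>2 + h"
  shows "p * (e u\<^sub>1 h - e u\<^sub>2 h) \<le> E (u\<^sub>2 + k) + E (u\<^sub>2 - k) - 2 * E u\<^sub>2"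
proof -
  have k: "k \<in> F" using assms by (simp add: k_def F_closed)
  have "u\<^sub>1 + h = u\<^sub>2 + k" by (simp add: k_def)
  then have "E u\<^sub>1 + p * e u\<^sub>1 h \<le> E (u\<^sub>2 + k)"
    using E_tangent[of u\<^sub>1 h] assms by simp
  moreover have "E u\<^sub>2 + p * e u\<^sub>2 (u\<^sub>1 - u\<^sub>2) \<le> E u\<^sub>1"
    using E_tangent[of u\<^sub>2 "u\<^sub>1 - u\<^sub>2"] assms by (simp add: F_closed)
  moreover have "e u\<^sub>2 k = e u\<^sub>2 (u\<^sub>1 - u\<^sub>2) + e u\<^sub>2 h"
    unfolding k_def using assms by (intro deriv_add_right F_closed)
  ultimately show ?thesis
    using E_remainder_le[OF assms(2) k] by (simp add: algebra_simps)
qed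

text \<open>The tangents at the endpoints a and b are both evaluated at the midpoint c. Strict
  convexity at c makes the sum of the two inequalities strict in the derivatives.\<close>

lemma strict_mono_deriv:
  assumes "u \<in> F" "v \<in> F" "v \<notin> const_funs"
  shows "strict_mono (\<lambda>t. e (u + t *\<^sub>f v) v)"
proof (rule strict_monoI)
  fix s t :: real
  assume "s < t"
  define d where "d = (t - s) / 2"
  have d: "0 < d" using \<open>s < t\<close> by (simp add: d_def)
  define a b c where "a = u + s *\<^sub>f v" and "b = u + t *\<^sub>f v" and "c = u + ((s + t) / 2) *\<^sub>f v"
  have abc: "a \<in> F" "b \<in> F" "c \<in> F" using assms by (auto simp: a_def b_def c_def F_closed)
  have eqs: "a + d *\<^sub>f v = c" "b + - (d *\<^sub>f v) = c" "c + d *\<^sub>f v = b" "c - d *\<^sub>f v = a"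
    by (simp_all add: a_def b_def c_def d_def fscale_def fun_eq_iff field_simps)
  have "d *\<^sub>f v \<notin> const_funs"
  proof
    assume "d *\<^sub>f v \<in> const_funs"
    then have "(1 / d) *\<^sub>f d *\<^sub>f v \<in> const_funs" by (rule scale_const)
    then show False using d assms by (simp add: fscale_def)
  qed
  then have "2 * E c < E b + E a"
    using E_strict_convex[of c "d *\<^sub>f v"] abc assms by (simp add: eqs F_closed)
  moreover have "E a + p * e a (d *\<^sub>f v) \<le> E c" "E b + p * e b (- (d *\<^sub>f v)) \<le> E c"
    using E_tangent[of a "d *\<^sub>f v"] E_tangent[of b "- (d *\<^sub>f v)"] abc assms by (auto simp only: eqs F_closed)
  ultimately have "0 < p * d * (e b v - e a v)"
    using abc assms by (simp add: deriv_scale_right deriv_minus_right F_closed algebra_simps)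
  then show "e (u + s *\<^sub>f v) v < e (u + t *\<^sub>f v) v"
    using zero_less_mult_pos[of "p * d" "e b v - e a v"] p_gt_1 d by (simp flip: a_def b_def)
qed

lemma strict_mono_deriv_iff:
  assumes "u \<in> F" "v \<in> F"
  shows "strict_mono (\<lambda>t. e (u + t *\<^sub>f v) v) \<longleftrightarrow> v \<notin> const_funs"
proof
  assume mono: "strict_mono (\<lambda>t. e (u + t *\<^sub>f v) v)"
  show "v \<notin> const_funs"
  proof
    assume "v \<in> const_funs"
    then have "e (u + t *\<^sub>f v) v = 0" for t using assms by (intro deriv_const_right F_closed)
    then show False using strict_monoD[OF mono, of 0 1] by (simp only:) simp
  qed
qed (use strict_mono_deriv assms in blast)

lemma deriv_Hoelder:
  assumes u: "u\<^sub>1 \<in> F" "u\<^sub>2 \<in> F" and v: "v \<in> F"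
  shows "\<bar>e u\<^sub>1 v - e u\<^sub>2 v\<bar>
    \<le> c_p p * max (N u\<^sub>1) (N u\<^sub>2) powr (p - 1 - alpha_p p) * N (u\<^sub>1 - u\<^sub>2) powr alpha_p p * N v"
proof -
  define d R where "d = N (u\<^sub>1 - u\<^sub>2)" and "R = max (N u\<^sub>1) (N u\<^sub>2)"
  define \<Delta> where "\<Delta> = \<bar>e u\<^sub>1 v - e u\<^sub>2 v\<bar>"
  have F12: "u\<^sub>1 - u\<^sub>2 \<in> F" using u by (rule F_diff)
  have d2R: "d \<le> 2 * R"
  proof -
    have "d \<le> N u\<^sub>1 + N u\<^sub>2"
      using N_triangle[of u\<^sub>1 "- u\<^sub>2"] u by (simp add: d_def N_minus F_closed)
    then show ?thesis by (simp add: R_def)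
  qed
  have "\<Delta> \<le> c_p p * R powr (p - 1 - alpha_p p) * d powr alpha_p p * N v"
  proof (cases "d = 0 \<or> N v = 0")
    case True
    then have "u\<^sub>1 - u\<^sub>2 \<in> const_funs \<or> v \<in> const_funs"
      using N_pos_iff[OF F12] N_pos_iff[OF v] by (auto simp: d_def)
    then have "\<Delta> = 0"
    proof
      assume "u\<^sub>1 - u\<^sub>2 \<in> const_funs"
      then have "e (u\<^sub>2 + (u\<^sub>1 - u\<^sub>2)) v = e u\<^sub>2 v" using u v by (intro deriv_add_const_left)
      then show ?thesis by (simp add: \<Delta>_def)
    qed (use u in \<open>simp add: \<Delta>_def deriv_const_right\<close>)
    then show ?thesis by (simp add: c_p_def N_nonneg)
  next
    case False
    then have d: "0 < d" and Nv: "0 < N v" using N_nonneg by (auto simp: d_def order.strict_iff_order)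
    then have R: "0 < R" using d2R by linarith
    \<comment> \<open>Makes the scaled direction as long as the difference of the two points, so
      that the increment k has norm at most 2 * d.\<close>
    define s where "s = d / N v"
    have s: "0 < s" using d Nv by (simp add: s_def)
    have \<Delta>_le: "p * (s * \<Delta>) \<le> B"
      if B: "\<And>k. k \<in> F \<Longrightarrow> N k \<le> 2 * d \<Longrightarrow> E (u\<^sub>2 + k) + E (u\<^sub>2 - k) - 2 * E u\<^sub>2 \<le> B" for B
    proof -
      have "p * (\<sigma> * (e u\<^sub>1 v - e u\<^sub>2 v)) \<le> B" if "\<bar>\<sigma>\<bar> = s" for \<sigma>
      proof -
        have "N (u\<^sub>1 - u\<^sub>2 + \<sigma> *\<^sub>f v) \<le> d + \<bar>\<sigma>\<bar> * N v"
          using N_triangle[OF F12, of "\<sigma> *\<^sub>f v"] v by (simp add: d_def F_closed N_scale)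
        then have "N (u\<^sub>1 - u\<^sub>2 + \<sigma> *\<^sub>f v) \<le> 2 * d" using that Nv by (simp add: s_def)
        then have "p * (e u\<^sub>1 (\<sigma> *\<^sub>f v) - e u\<^sub>2 (\<sigma> *\<^sub>f v)) \<le> B"
          using deriv_diff_le[OF u, of "\<sigma> *\<^sub>f v"] B[of "u\<^sub>1 - u\<^sub>2 + \<sigma> *\<^sub>f v"] F12 v
          by (simp add: F_closed)
        then show ?thesis using u v by (simp add: deriv_scale_right algebra_simps)
      qed
      from this[of s] this[of "- s"] s show ?thesis
        by (cases "0 \<le> e u\<^sub>1 v - e u\<^sub>2 v") (auto simp: \<Delta>_def right_diff_distrib)
    qed
    show ?thesis
    proof (cases "p \<le> 2")
      case True
      have alpha: "alpha_p p = (p - 1) / p"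
        using True p_gt_1 by (simp add: alpha_p_def min_def divide_le_cancel)
      have "p * (s * \<Delta>) \<le> 2 * (2 * d) powr p"
      proof (rule \<Delta>_le)
        fix k assume k: "k \<in> F" "N k \<le> 2 * d"
        have "E (u\<^sub>2 + k) + E (u\<^sub>2 - k) - 2 * E u\<^sub>2 \<le> 2 * (N u\<^sub>2 powr p + N k powr p) powr 0 * N k powr p"
          using second_difference_le[OF u(2) k(1)] True p_gt_1 by (simp add: smooth_exponent_def smooth_constant_def)
        \<comment> \<open>The exponent p / q - 1 is 0 here. Since \<open>0 powr 0 = 0\<close>, the
          factor is bounded by 1 rather than equal to it.\<close>
        also have "\<dots> \<le> 2 * 1 * (2 * d) powr p"
          using k p_gt_1 by (intro mult_mono powr_mono2) (auto simp: N_nonneg)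
        finally show "E (u\<^sub>2 + k) + E (u\<^sub>2 - k) - 2 * E u\<^sub>2 \<le> 2 * (2 * d) powr p" by simp
      qed
      moreover have "s * \<Delta> \<le> p * (s * \<Delta>)"
        using p_gt_1 s by (simp add: mult_le_cancel_right1 \<Delta>_def not_less)
      ultimately have "s * \<Delta> \<le> 2 * (2 * d) powr p" by linarith
      also have "(2 * d) powr p = 2 powr p * (d * d powr (p - 1))"
        using d by (simp add: powr_mult powr_mult_base)
      also have "2 * (2 powr p * (d * d powr (p - 1))) = s * (2 * 2 powr p * d powr (p - 1) * N v)"
        using Nv by (simp add: s_def)
      finally have "\<Delta> \<le> 2 * 2 powr p * d powr (p - 1) * N v" using s by simp
      \<comment> \<open>The nonnegative surplus exponent of d is traded for a power of R by d \<le>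
        2 * R, at the cost of at most \<open>2 powr p\<close>.\<close>
      also have "d powr (p - 1) = d powr alpha_p p * d powr (p - 1 - alpha_p p)"
        by (simp flip: powr_add)
      also have "2 * 2 powr p * (d powr alpha_p p * d powr (p - 1 - alpha_p p)) * N v
          \<le> 2 * 2 powr p * (d powr alpha_p p * (2 powr p * R powr (p - 1 - alpha_p p))) * N v"
      proof (intro mult_left_mono mult_right_mono)
        have "(p - 1) / p \<le> p - 1" using divide_left_mono[of 1 p "p - 1"] p_gt_1 by simp
        then have ex: "0 \<le> p - 1 - alpha_p p" by (simp add: alpha)
        have "d powr (p - 1 - alpha_p p) \<le> (2 * R) powr (p - 1 - alpha_p p)"
          using d d2R ex by (intro powr_mono2) auto
        also have "\<dots> = 2 powr (p - 1 - alpha_p p) * R powr (p - 1 - alpha_p p)"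
          using R by (simp add: powr_mult)
        also have "\<dots> \<le> 2 powr p * R powr (p - 1 - alpha_p p)"
        proof (intro mult_right_mono powr_mono)
          have "0 \<le> (p - 1) / p" using p_gt_1 by simp
          then show "p - 1 - alpha_p p \<le> p" unfolding alpha by linarith
        qed auto
        finally show "d powr (p - 1 - alpha_p p) \<le> 2 powr p * R powr (p - 1 - alpha_p p)" .
      qed (use Nv in auto)
      also have "\<dots> = (2 * 2 powr p * 2 powr p) * R powr (p - 1 - alpha_p p) * d powr alpha_p p * N v"
        by (simp only: mult_ac)
      also have "2 * 2 powr p * 2 powr p = c_p p"
        unfolding c_p_def mult_2 powr_add by simp
      finally show ?thesis .
    next
      case False
      then have p2: "2 < p" by simp
      have alpha: "alpha_p p = 1 / p"
        using p2 by (simp add: alpha_p_def min_def divide_le_cancel)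
      have cp: "c_p p = 2 * 4 powr p"
      proof -
        have "(4::real) powr p = (2 powr 2) powr p" by simp
        also have "\<dots> = 2 powr (2 * p)" by (simp only: powr_powr)
        finally show ?thesis unfolding c_p_def powr_add by simp
      qed
      \<comment> \<open>If \<open>d \<ge> \<tau> * R\<close>, the trivial bound from \<open>deriv_le\<close> suffices. Otherwise \<open>4 * p * d \<le> R\<close>, so
        \<open>d\<close> has almost no influence on the base \<open>Q\<close> of the power in \<open>second_difference_le\<close>.\<close>
      define \<tau> where "\<tau> = 4 powr (- p\<^sup>2)"
      show ?thesis
      proof (cases "\<tau> * R \<le> d")
        case True
        have "\<Delta> \<le> 2 * R powr (p - 1) * N v"
        proof -
          have "\<bar>e u\<^sub>i v\<bar> \<le> R powr (p - 1) * N v" if "u\<^sub>i \<in> F" "N u\<^sub>i \<le> R" for u\<^sub>i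
            using deriv_le[OF that(1) v] that(2) p2 Nv
            by (elim order_trans) (intro mult_right_mono powr_mono2, auto simp: N_nonneg)
          from this[of u\<^sub>1] this[of u\<^sub>2] u show ?thesis by (simp add: \<Delta>_def R_def)
        qed
        also have "R powr (p - 1) = R powr (p - 1 - alpha_p p) * R powr alpha_p p"
          by (simp flip: powr_add)
        also have "2 * (R powr (p - 1 - alpha_p p) * R powr alpha_p p) * N v
            \<le> 2 * (R powr (p - 1 - alpha_p p) * (4 powr p * d powr alpha_p p)) * N v"
        proof (intro mult_left_mono mult_right_mono)
          \<comment> \<open>The value of \<tau> comes from here: under the power 1 / p it costs
            exactly the factor \<open>4 powr p\<close> available in \<open>c_p\<close>.\<close>
          have "R \<le> 4 powr (p\<^sup>2) * d"
            using True by (simp add: \<tau>_def powr_minus field_simps)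
          then have "R powr alpha_p p \<le> (4 powr (p\<^sup>2) * d) powr alpha_p p"
            using R p2 by (intro powr_mono2) (auto simp: alpha)
          also have "\<dots> = 4 powr p * d powr alpha_p p"
            using d p2 by (simp add: powr_mult powr_powr alpha power2_eq_square)
          finally show "R powr alpha_p p \<le> 4 powr p * d powr alpha_p p" .
        qed (use Nv in auto)
        finally show ?thesis by (simp add: cp mult_ac)
      next
        case False
        have exp1: "exp 1 \<le> (4::real)" using exp_le by simp
        have "4 * p\<^sup>2 \<le> 4 powr (p\<^sup>2)" using p2 by (intro linear_le_powr exp1) auto
        moreover have "p \<le> p\<^sup>2" using p2 by (simp add: power2_eq_square)
        ultimately have "4 * p \<le> 4 powr (p\<^sup>2)" by linarith
        then have "\<tau> \<le> 1 / (4 * p)"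
          unfolding \<tau>_def powr_minus inverse_eq_divide using p2 by (intro divide_left_mono) auto
        then have "\<tau> * R \<le> 1 / (4 * p) * R" using R by (intro mult_right_mono) auto
        then have "d \<le> R / (4 * p)" using False by simp
        then have dR: "4 * p * d \<le> R" using p2 by (simp add: field_simps)
        then have dR': "d \<le> R" using p2 d
          by (smt (verit) mult_le_cancel_right1)
        \<comment> \<open>The largest base in \<open>second_difference_le\<close> for exponent 2 and
          weight 2 * p, given the bounds R on \<open>N u\<^sub>2\<close> and 2 * d on N k.\<close>
        define Q where "Q = R powr 2 + 2 * p * (2 * d) powr 2"
        have Q: "Q powr (p / 2 - 1) \<le> 2 * R powr (p - 2)"
        proof -
          \<comment> \<open>So Q exceeds \<open>R\<^sup>2\<close> by a factor of at most exp (1 / (2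
            * p)), and the power p / 2 - 1 of this factor is at most exp (1 / 4), whatever p
            is.\<close>
          have "(4 * p * d)\<^sup>2 \<le> R\<^sup>2" using dR d p2 by (intro power_mono) auto
          then have "8 * p * d\<^sup>2 \<le> R\<^sup>2 * (1 / (2 * p))" using p2 by (simp add: field_simps power2_eq_square)
          then have "Q \<le> R\<^sup>2 * (1 + 1 / (2 * p))" using R d by (simp add: Q_def algebra_simps)
          also have "\<dots> \<le> R\<^sup>2 * exp (1 / (2 * p))"
            by (intro mult_left_mono exp_ge_add_one_self) auto
          finally have "Q powr (p / 2 - 1) \<le> (R\<^sup>2 * exp (1 / (2 * p))) powr (p / 2 - 1)"
            using p2 R d by (intro powr_mono2) (auto simp: Q_def)
          also have "\<dots> = (R powr 2) powr (p / 2 - 1) * exp (1 / (2 * p) * (p / 2 - 1))"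
            using R by (simp add: powr_mult exp_powr_real)
          also have "(R powr 2) powr (p / 2 - 1) = R powr (p - 2)"
            by (simp only: powr_powr) (simp add: algebra_simps)
          also have "exp (1 / (2 * p) * (p / 2 - 1)) \<le> 2"
          proof -
            have "1 / (2 * p) * (p / 2 - 1) \<le> 1 / 4" using p2 by (simp add: field_simps)
            then have "exp (1 / (2 * p) * (p / 2 - 1)) \<le> exp (1 / 4)" by simp
            also have "\<dots> \<le> 2" using exp_bound[of "1 / 4"] by (simp add: power2_eq_square)
            finally show ?thesis .
          qed
          finally show ?thesis using R by (simp add: mult_ac)
        qed
        have "p * (s * \<Delta>) \<le> 2 * p\<^sup>2 * (2 * R powr (p - 2)) * (2 * d) powr 2"
        proof (rule \<Delta>_le)
          fix k assume k: "k \<in> F" "N k \<le> 2 * d"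
          have "E (u\<^sub>2 + k) + E (u\<^sub>2 - k) - 2 * E u\<^sub>2
              \<le> 2 * p\<^sup>2 * (N u\<^sub>2 powr 2 + 2 * p * N k powr 2) powr (p / 2 - 1) * N k powr 2"
            using second_difference_le[OF u(2) k(1)] p2
            by (simp add: smooth_exponent_def smooth_constant_def min_def power2_eq_square mult_ac)
          also have "\<dots> \<le> 2 * p\<^sup>2 * Q powr (p / 2 - 1) * (2 * d) powr 2"
            unfolding Q_def using k p2 R d
            by (intro mult_mono mult_left_mono powr_mono2 add_mono)
              (auto simp: N_nonneg R_def)
          also have "\<dots> \<le> 2 * p\<^sup>2 * (2 * R powr (p - 2)) * (2 * d) powr 2"
            using Q by (intro mult_right_mono mult_left_mono) auto
          finally show "E (u\<^sub>2 + k) + E (u\<^sub>2 - k) - 2 * E u\<^sub>2 \<le> \<dots>" .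
        qed
        also have "\<dots> = p * (s * (16 * p * R powr (p - 2) * d * N v))"
          using d Nv by (simp add: s_def power2_eq_square)
        finally have "\<Delta> \<le> 16 * p * R powr (p - 2) * d * N v"
          using p2 s by simp
        \<comment> \<open>As for p \<le> 2, the surplus power of d is traded for one of R, now by d
          \<le> R.\<close>
        also have "d = d powr alpha_p p * d powr (1 - alpha_p p)"
          using d by (simp flip: powr_add)
        also have "16 * p * R powr (p - 2) * (d powr alpha_p p * d powr (1 - alpha_p p)) * N v
            \<le> c_p p * R powr (p - 2) * (d powr alpha_p p * R powr (1 - alpha_p p)) * N v"
        proof (intro mult_right_mono mult_mono order_refl powr_mono2)
          \<comment> \<open>Hence \<open>c_p p\<close> = 8 * \<open>4 powr (p - 1)\<close> is at
            least 32 * (p - 1), which is at least 16 * p for p \<ge> 2.\<close>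
          have "4 * (p - 1) \<le> 4 powr (p - 1)" using p2 by (intro linear_le_powr exp1) auto
          moreover have "4 powr p = 4 * 4 powr (p - 1)" by (simp add: powr_mult_base)
          ultimately show "16 * p \<le> c_p p" using p2 by (simp add: cp)
        qed (use p2 d dR' Nv in \<open>auto simp: cp alpha\<close>)
        also have "\<dots> = c_p p * (R powr (p - 2) * R powr (1 - alpha_p p)) * d powr alpha_p p * N v"
          by (simp only: mult_ac)
        also have "R powr (p - 2) * R powr (1 - alpha_p p) = R powr (p - 1 - alpha_p p)"
          by (simp flip: powr_add add: algebra_simps)
        finally show ?thesis .
      qed
    qed
  qed
  then show ?thesis by (simp add: \<Delta>_def d_def R_def)
qed

section \<open>Frechet differentiability on the quotient\<close>

lemma quot_fun_coset: "u \<in> F \<Longrightarrow> quot_fun E (u +o const_funs) = E u"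
  unfolding quot_fun_def by (intro the_elem_coset E_add_const)

lemma quot_norm_coset: "u \<in> F \<Longrightarrow> quot_norm p E (u +o const_funs) = N u"
  by (simp add: quot_norm_def quot_fun_coset N_def)

text \<open>The derivative p * e u v depends only on the coset of v. The remainder lies between 0,
  by the tangent inequality, and the second difference, whose smallness is uniform in the
  direction.\<close>

lemma frechet_differentiable_coset:
  assumes u: "u \<in> F"
  shows "frechet_differentiable_at (quot F) (+) quot_scale (quot_norm p E) (quot_fun E) (u +o const_funs)"
proof -
  define D where "D X = the_elem ((\<lambda>v. p * e u v) ` X)" for X
  have D: "D (v +o const_funs) = p * e u v" if "v \<in> F" for v
    unfolding D_def using that u const_funs_subset
    by (intro the_elem_coset) (auto simp: deriv_add_right deriv_const_right)
  show ?thesis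
    unfolding frechet_differentiable_at_def
  proof (intro exI[of _ D] conjI allI impI)
    show "linear_functional_on (quot F) (+) quot_scale D"
      using u by (auto simp: linear_functional_on_def quot_def coset_add quot_scale_coset D F_closed
          deriv_add_right deriv_scale_right algebra_simps)
    show "\<exists>C. \<forall>h\<in>quot F. \<bar>D h\<bar> \<le> C * quot_norm p E h"
    proof (intro exI[of _ "p * N u powr (p - 1)"] ballI)
      fix h assume "h \<in> quot F"
      then obtain v where v: "v \<in> F" "h = v +o const_funs" by (auto simp: quot_def)
      then show "\<bar>D h\<bar> \<le> p * N u powr (p - 1) * quot_norm p E h"
        using deriv_le[OF u v(1)] p_gt_1 by (simp add: D quot_norm_coset abs_mult)
    qed
    fix \<epsilon> :: real
    assume "0 < \<epsilon>"
    then obtain \<delta> where \<delta>: "0 < \<delta>"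
      "\<And>h. h \<in> F \<Longrightarrow> N h < \<delta> \<Longrightarrow> E (u + h) + E (u - h) - 2 * E u \<le> \<epsilon> * N h"
      using second_difference_small[OF u] by blast
    show "\<exists>\<delta>>0. \<forall>h\<in>quot F. quot_norm p E h < \<delta> \<longrightarrow>
        \<bar>quot_fun E (u +o const_funs + h) - quot_fun E (u +o const_funs) - D h\<bar> \<le> \<epsilon> * quot_norm p E h"
    proof (intro exI[of _ \<delta>] conjI ballI impI \<delta>(1))
      fix h assume "h \<in> quot F" "quot_norm p E h < \<delta>"
      then obtain v where v: "v \<in> F" "h = v +o const_funs" "N v < \<delta>"
        by (auto simp: quot_def quot_norm_coset)
      then have "\<bar>E (u + v) - E u - p * e u v\<bar> \<le> \<epsilon> * N v"
        using E_tangent[OF u v(1)] E_remainder_le[OF u v(1)] \<delta>(2)[of v] by linarith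
      then show "\<bar>quot_fun E (u +o const_funs + h) - quot_fun E (u +o const_funs) - D h\<bar> \<le> \<epsilon> * quot_norm p E h"
        using u v by (simp add: coset_add quot_fun_coset quot_norm_coset D F_closed)
    qed
  qed
qed

end

theorem theorem2p7:
  fixes p :: real and F :: "('k \<Rightarrow> real) set" and E :: "('k \<Rightarrow> real) \<Rightarrow> real"
  assumes "1 < p" and "p_resistance_form p F E"
  shows
    "(\<forall>X \<in> quot F. frechet_differentiable_at (quot F) (+) quot_scale (quot_norm p E) (quot_fun E) X) \<and>
     (\<forall>u\<in>F. \<forall>v\<in>F. (\<lambda>t::real. E (u + t *\<^sub>f v)) field_differentiable at 0) \<and>
     (\<forall>u\<in>F. linear_functional_on F (+) (*\<^sub>f) (form_deriv p E u)) \<and>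
     (\<forall>u\<in>F. form_deriv p E u u = E u) \<and>
     (\<forall>u\<in>F. form_deriv p E u 1 = 0) \<and>
     (\<forall>u\<in>F. \<forall>v\<in>F. strict_mono (\<lambda>t::real. form_deriv p E (u + t *\<^sub>f v) v) \<longleftrightarrow> v \<notin> const_funs) \<and>
     (\<forall>u\<in>F. \<forall>v\<in>F. \<forall>a::real.
        form_deriv p E (a *\<^sub>f u) v = sgn a * \<bar>a\<bar> powr (p - 1) * form_deriv p E u v \<and>
        form_deriv p E (u + a *\<^sub>f 1) v = form_deriv p E u v) \<and>
     (\<forall>u\<in>F. \<forall>v\<in>F. \<bar>form_deriv p E u v\<bar> \<le> E u powr ((p - 1) / p) * E v powr (1 / p)) \<and>
     0 < c_p p \<and>
     (\<forall>u\<^sub>1\<in>F. \<forall>u\<^sub>2\<in>F. \<forall>v\<in>F.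
        \<bar>form_deriv p E u\<^sub>1 v - form_deriv p E u\<^sub>2 v\<bar>
          \<le> c_p p * max (E u\<^sub>1) (E u\<^sub>2) powr ((p - 1 - alpha_p p) / p)
              * E (u\<^sub>1 - u\<^sub>2) powr (alpha_p p / p) * E v powr (1 / p))"
proof -
  interpret p_resistance p F E
    using assms by (simp add: p_resistance_def p_resistance_axioms_def)
  have "(1 :: 'k \<Rightarrow> real) \<in> const_funs"
    using const_const[of 1] by (simp add: fscale_def fun_eq_iff one_fun_def)
  \<comment> \<open>Powers of E, and below those of the maximum, are rewritten as powers of
    \<open>N\<close>, the form in which the estimates were proved.\<close>
  moreover have E_root: "E u powr (b / p) = N u powr b" if "u \<in> F" for u b
    using assms(1) that by (simp add: E_eq_N_powr powr_powr)
  moreover have "max (E u) (E v) powr (b / p) = max (N u) (N v) powr b" if "u \<in> F" "v \<in> F" for u v b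
  proof (cases "N u \<le> N v")
    case True
    then have "E u \<le> E v" using that assms(1) by (simp add: E_eq_N_powr powr_mono2 N_nonneg)
    then show ?thesis using True that by (simp add: max_absorb2 E_root)
  next
    case False
    then have "E v \<le> E u" using that assms(1) by (simp add: E_eq_N_powr powr_mono2 N_nonneg)
    then show ?thesis using False that by (simp add: max_absorb1 E_root)
  qed
  moreover have "E v powr (1 / p) = N v" for v
    by (simp add: N_def)
  moreover have "0 < c_p p"
    by (simp add: c_p_def)
  moreover have "\<forall>X\<in>quot F. frechet_differentiable_at (quot F) (+) quot_scale (quot_norm p E) (quot_fun E) X"
    using frechet_differentiable_coset by (auto simp: quot_def)
  moreover have "\<forall>u\<in>F. \<forall>v\<in>F. (\<lambda>t::real. E (u + t *\<^sub>f v)) field_differentiable at 0"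
    using E_has_derivative unfolding field_differentiable_def by blast
  ultimately show ?thesis
    by (simp add: deriv_linear deriv_self deriv_const_right strict_mono_deriv_iff deriv_scale_left
        deriv_add_const_left const_const deriv_le deriv_Hoelder F_diff)
qed

end
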